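(* Let $\mathbb K$ be a definably complete, locally o-minimal structure expanding an ordered field, let $(a,b)\subseteq\mathbb K$ be a nonempty open interval, and let $f:(a,b)\to\mathbb K$ be a definable function. Then there exists a pseudo-finite set $A\subseteq(a,b)$ such that for every $x\in A\cup\{a\}$, on the subinterval $(x,s(x))$ the function $f$ is either constant, or strictly monotone and continuous.
   Context: Definable means definable with parameters. A linearly ordered structure is definably complete if every definable subset of its domain has a supremum in the domain together with $\pm\infty$. $\mathbb K$ is locally o-minimal if for every definable $f:\mathbb K\to\mathbb K$ and every $x\in\mathbb K$ there is $y>x$ such that $f>0$ on $(x,y)$, or $f=0$ on $(x,y)$, or $f<0$ on $(x,y)$. A definable set is pseudo-finite if it is closed, bounded and discrete (the empty set is allowed). For a pseudo-finite $A\subseteq(a,b)$ and $x\in A$, $s(x)$ denotes the smallest element of $A$ strictly greater than $x$ if $x\neq\max A$, and $s(x)=b$ if $x=\max A$; $s(a)$ denotes $\min A$ (and $s(a)=b$ if $A=\emptyset$). Endpoints satisfy $a<b$ in $\mathbb K\cup\{\pm\infty\}$. *)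

theory Defs
  imports "HOL-Analysis.Analysis" "HOL-Library.Extended"
begin

text \<open>
  First-order structures expanding an ordered field. The universe is a type \<open>'a\<close> in the class
  of linearly ordered fields; the symbols of the language of ordered rings are built into the
  syntax of terms and formulas with their fixed meaning, and a structure interprets an arbitrary
  further signature. A symbol whose arity is \<open>None\<close> does not belong to the signature, so that
  the signature may be empty although the symbol types \<open>'f\<close> and \<open>'r\<close> are not.
\<close>

record ('a, 'f, 'r) expansion =
  fn_arity :: "'f \<Rightarrow> nat option"
  fn_val :: "'f \<Rightarrow> 'a list \<Rightarrow> 'a"
  rel_arity :: "'r \<Rightarrow> nat option"
  rel_val :: "'r \<Rightarrow> 'a list \<Rightarrow> bool"

text \<open>\<open>Param c\<close> is a name for the element \<open>c\<close> of the universe.\<close>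

datatype ('a, 'f) fo_term =
    Var nat
  | Param 'a
  | Zero
  | One
  | Uminus "('a, 'f) fo_term"
  | Plus "('a, 'f) fo_term" "('a, 'f) fo_term"
  | Times "('a, 'f) fo_term" "('a, 'f) fo_term"
  | App 'f "('a, 'f) fo_term list"

datatype ('a, 'f, 'r) fo_form =
    Equal "('a, 'f) fo_term" "('a, 'f) fo_term"
  | Less "('a, 'f) fo_term" "('a, 'f) fo_term"
  | Rel 'r "('a, 'f) fo_term list"
  | Neg "('a, 'f, 'r) fo_form"
  | Conj "('a, 'f, 'r) fo_form" "('a, 'f, 'r) fo_form"
  | Exist nat "('a, 'f, 'r) fo_form"

fun term_vars :: "('a, 'f) fo_term \<Rightarrow> nat set" where
  "term_vars (Var i) = {i}"
| "term_vars (Param c) = {}"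
| "term_vars Zero = {}"
| "term_vars One = {}"
| "term_vars (Uminus t) = term_vars t"
| "term_vars (Plus t u) = term_vars t \<union> term_vars u"
| "term_vars (Times t u) = term_vars t \<union> term_vars u"
| "term_vars (App g ts) = (\<Union>t\<in>set ts. term_vars t)"

fun free_vars :: "('a, 'f, 'r) fo_form \<Rightarrow> nat set" where
  "free_vars (Equal t u) = term_vars t \<union> term_vars u"
| "free_vars (Less t u) = term_vars t \<union> term_vars u"
| "free_vars (Rel r ts) = (\<Union>t\<in>set ts. term_vars t)"
| "free_vars (Neg \<phi>) = free_vars \<phi>"
| "free_vars (Conj \<phi> \<psi>) = free_vars \<phi> \<union> free_vars \<psi>"
| "free_vars (Exist i \<phi>) = free_vars \<phi> - {i}"

fun wf_term :: "('a, 'f, 'r) expansion \<Rightarrow> ('a, 'f) fo_term \<Rightarrow> bool" where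
  "wf_term M (Var i) = True"
| "wf_term M (Param c) = True"
| "wf_term M Zero = True"
| "wf_term M One = True"
| "wf_term M (Uminus t) = wf_term M t"
| "wf_term M (Plus t u) = (wf_term M t \<and> wf_term M u)"
| "wf_term M (Times t u) = (wf_term M t \<and> wf_term M u)"
| "wf_term M (App g ts) = (fn_arity M g = Some (length ts) \<and> (\<forall>t\<in>set ts. wf_term M t))"

fun wf_form :: "('a, 'f, 'r) expansion \<Rightarrow> ('a, 'f, 'r) fo_form \<Rightarrow> bool" where
  "wf_form M (Equal t u) = (wf_term M t \<and> wf_term M u)"
| "wf_form M (Less t u) = (wf_term M t \<and> wf_term M u)"
| "wf_form M (Rel r ts) = (rel_arity M r = Some (length ts) \<and> (\<forall>t\<in>set ts. wf_term M t))"
| "wf_form M (Neg \<phi>) = wf_form M \<phi>"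
| "wf_form M (Conj \<phi> \<psi>) = (wf_form M \<phi> \<and> wf_form M \<psi>)"
| "wf_form M (Exist i \<phi>) = wf_form M \<phi>"

fun term_val ::
  "('a::linordered_field, 'f, 'r) expansion \<Rightarrow> (nat \<Rightarrow> 'a) \<Rightarrow> ('a, 'f) fo_term \<Rightarrow> 'a" where
  "term_val M e (Var i) = e i"
| "term_val M e (Param c) = c"
| "term_val M e Zero = 0"
| "term_val M e One = 1"
| "term_val M e (Uminus t) = - term_val M e t"
| "term_val M e (Plus t u) = term_val M e t + term_val M e u"
| "term_val M e (Times t u) = term_val M e t * term_val M e u"
| "term_val M e (App g ts) = fn_val M g (map (term_val M e) ts)"

fun sat ::
  "('a::linordered_field, 'f, 'r) expansion \<Rightarrow> (nat \<Rightarrow> 'a) \<Rightarrow> ('a, 'f, 'r) fo_form \<Rightarrow> bool" where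
  "sat M e (Equal t u) = (term_val M e t = term_val M e u)"
| "sat M e (Less t u) = (term_val M e t < term_val M e u)"
| "sat M e (Rel r ts) = rel_val M r (map (term_val M e) ts)"
| "sat M e (Neg \<phi>) = (\<not> sat M e \<phi>)"
| "sat M e (Conj \<phi> \<psi>) = (sat M e \<phi> \<and> sat M e \<psi>)"
| "sat M e (Exist i \<phi>) = (\<exists>x. sat M (e(i := x)) \<phi>)"

text \<open>
  Definability with parameters of a subset of the \<open>n\<close>-th Cartesian power, whose points are lists
  of length \<open>n\<close>. All free variables have an index below \<open>n\<close>, so the values \<open>xs ! i\<close> with
  \<open>i \<ge> n\<close> are irrelevant.
\<close>

definition definable ::
  "('a::linordered_field, 'f, 'r) expansion \<Rightarrow> nat \<Rightarrow> 'a list set \<Rightarrow> bool" where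
  "definable M n A \<longleftrightarrow>
    (\<exists>\<phi>. wf_form M \<phi> \<and> free_vars \<phi> \<subseteq> {..<n} \<and> A = {xs. length xs = n \<and> sat M (\<lambda>i. xs ! i) \<phi>})"

definition definable_set ::
  "('a::linordered_field, 'f, 'r) expansion \<Rightarrow> 'a set \<Rightarrow> bool" where
  "definable_set M A \<longleftrightarrow> definable M 1 ((\<lambda>x. [x]) ` A)"

definition definable_fun_on ::
  "('a::linordered_field, 'f, 'r) expansion \<Rightarrow> 'a set \<Rightarrow> ('a \<Rightarrow> 'a) \<Rightarrow> bool" where
  "definable_fun_on M X f \<longleftrightarrow> definable M 2 ((\<lambda>x. [x, f x]) ` X)"

definition definably_complete :: "('a::linordered_field, 'f, 'r) expansion \<Rightarrow> bool" where
  "definably_complete M \<longleftrightarrow>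
    (\<forall>X. definable_set M X \<longrightarrow>
      (\<exists>s::'a extended. (\<forall>x\<in>X. Fin x \<le> s) \<and> (\<forall>u. (\<forall>x\<in>X. Fin x \<le> u) \<longrightarrow> s \<le> u)))"

definition locally_o_minimal :: "('a::linordered_field, 'f, 'r) expansion \<Rightarrow> bool" where
  "locally_o_minimal M \<longleftrightarrow>
    (\<forall>f. definable_fun_on M UNIV f \<longrightarrow>
      (\<forall>x. \<exists>y>x. (\<forall>t\<in>{x<..<y}. f t > 0) \<or> (\<forall>t\<in>{x<..<y}. f t = 0) \<or> (\<forall>t\<in>{x<..<y}. f t < 0)))"

text \<open>The topology is the order topology, and boundedness refers to the order.\<close>

definition pseudo_finite ::
  "('a::{linordered_field, linorder_topology}, 'f, 'r) expansion \<Rightarrow> 'a set \<Rightarrow> bool" where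
  "pseudo_finite M A \<longleftrightarrow>
    definable_set M A \<and> closed A \<and> bdd_below A \<and> bdd_above A \<and> discrete A"

text \<open>The interval of \<open>'a\<close> with possibly infinite endpoints.\<close>

definition ext_interval :: "'a::linorder extended \<Rightarrow> 'a extended \<Rightarrow> 'a set" where
  "ext_interval a b = {t. a < Fin t \<and> Fin t < b}"

text \<open>
  The successor function on \<open>A \<union> {a}\<close> for \<open>A\<close> contained in the interval \<open>(a, b)\<close>. A pseudo-finite
  set need not be finite, hence \<open>Min\<close> and \<open>Max\<close> are not applicable.
\<close>

definition next_point ::
  "'a::linorder extended \<Rightarrow> 'a extended \<Rightarrow> 'a set \<Rightarrow> 'a extended \<Rightarrow> 'a extended" where
  "next_point a b A x =
    (if x = a then (if A = {} then b else Fin (LEAST y. y \<in> A))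
     else if \<forall>y\<in>A. Fin y \<le> x then b
     else Fin (LEAST y. y \<in> A \<and> x < Fin y))"

end

theory Submission
  imports Defs
begin

text \<open>
  Call a definable set thin if it contains no interval. By local o-minimality (at points and, via
  reciprocals, at infinity) thin sets are pseudo-finite, so their nonempty definable subsets have
  minima; this allows induction along thin sets, which shows that definable images of thin sets
  are thin. Consequently a positive radius depending definably on a point can be chosen uniformly
  on a subinterval. To the right of every \<open>x\<close> the sign of \<open>f t - f x\<close> is eventually constant;
  uniformity turns this into monotonicity of \<open>f\<close> on some subinterval of any given interval. If the
  monotonicity is strict, the image contains an interval, which gives continuity on a smaller
  subinterval. So the points near which \<open>f\<close> does not behave well form a thin set \<open>A\<close>, and between
  neighbouring points of \<open>A\<close> a supremum argument passes from local to global behaviour.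
\<close>

section \<open>Closure properties of definability\<close>

fun rename_term :: "(nat \<Rightarrow> nat) \<Rightarrow> ('a, 'f) fo_term \<Rightarrow> ('a, 'f) fo_term" where
  "rename_term r (Var i) = Var (r i)"
| "rename_term r (Param c) = Param c"
| "rename_term r Zero = Zero"
| "rename_term r One = One"
| "rename_term r (Uminus t) = Uminus (rename_term r t)"
| "rename_term r (Plus t u) = Plus (rename_term r t) (rename_term r u)"
| "rename_term r (Times t u) = Times (rename_term r t) (rename_term r u)"
| "rename_term r (App g ts) = App g (map (rename_term r) ts)"

fun rename_form :: "(nat \<Rightarrow> nat) \<Rightarrow> ('a, 'f, 'r) fo_form \<Rightarrow> ('a, 'f, 'r) fo_form" where
  "rename_form r (Equal t u) = Equal (rename_term r t) (rename_term r u)"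
| "rename_form r (Less t u) = Less (rename_term r t) (rename_term r u)"
| "rename_form r (Rel R ts) = Rel R (map (rename_term r) ts)"
| "rename_form r (Neg \<phi>) = Neg (rename_form r \<phi>)"
| "rename_form r (Conj \<phi> \<psi>) = Conj (rename_form r \<phi>) (rename_form r \<psi>)"
| "rename_form r (Exist i \<phi>) = Exist (r i) (rename_form r \<phi>)"

lemma wf_rename_term: "wf_term M (rename_term r t) = wf_term M t"
  by (induction t) auto

lemma wf_rename_form: "wf_form M (rename_form r \<phi>) = wf_form M \<phi>"
  by (induction \<phi>) (auto simp: wf_rename_term)

lemma term_val_rename: "term_val M e (rename_term r t) = term_val M (e \<circ> r) t"
  by (induction t) (auto simp: comp_def cong: map_cong)

text \<open>Bound variables are renamed together with the free ones, so injectivity of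
  \<open>r\<close> is what rules out capture: updating at \<open>r i\<close> and then composing with
  \<open>r\<close> agrees with composing first and updating at \<open>i\<close>.\<close>

lemma sat_rename:
  assumes "inj r"
  shows "sat M e (rename_form r \<phi>) = sat M (e \<circ> r) \<phi>"
proof (induction \<phi> arbitrary: e)
  case (Rel R ts)
  then show ?case by (simp add: term_val_rename comp_def)
next
  case (Exist i \<phi>)
  have "e(r i := x) \<circ> r = (e \<circ> r)(i := x)" for x
    using assms by (auto simp: fun_eq_iff inj_def)
  then show ?case by (simp only: rename_form.simps sat.simps Exist.IH)
qed (simp_all add: term_val_rename)

lemma term_val_cong:
  "(\<And>i. i \<in> term_vars t \<Longrightarrow> e i = e' i) \<Longrightarrow> term_val M e t = term_val M e' t"
proof (induction t)
  case (App g ts)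
  have "term_val M e t = term_val M e' t" if "t \<in> set ts" for t
    by (rule App.IH[OF that], rule App.prems) (use that in auto)
  then have "map (term_val M e) ts = map (term_val M e') ts" by (intro map_cong refl)
  then show ?case by (metis term_val.simps(8))
qed auto

lemma sat_cong:
  "(\<And>i. i \<in> free_vars \<phi> \<Longrightarrow> e i = e' i) \<Longrightarrow> sat M e \<phi> = sat M e' \<phi>"
proof (induction \<phi> arbitrary: e e')
  case (Equal t u)
  then show ?case using term_val_cong[of t e e' M] term_val_cong[of u e e' M] by auto
next
  case (Less t u)
  then show ?case using term_val_cong[of t e e' M] term_val_cong[of u e e' M] by auto
next
  case (Rel R ts)
  have "term_val M e t = term_val M e' t" if "t \<in> set ts" for t
    by (rule term_val_cong, rule Rel.prems) (use that in auto)
  then have "map (term_val M e) ts = map (term_val M e') ts" by (intro map_cong refl)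
  then show ?case by (metis sat.simps(3))
next
  case (Neg \<phi>)
  then show ?case by (metis free_vars.simps(4) sat.simps(4))
next
  case (Conj \<phi> \<psi>)
  have "sat M e \<phi> = sat M e' \<phi>" "sat M e \<psi> = sat M e' \<psi>"
    by (rule Conj.IH, rule Conj.prems, simp)+
  then show ?case by simp
next
  case (Exist i \<phi>)
  have "sat M (e(i := x)) \<phi> = sat M (e'(i := x)) \<phi>" for x
    by (rule Exist.IH) (use Exist.prems in auto)
  then show ?case by simp
qed

lemma finite_term_vars: "finite (term_vars t)"
  by (induction t) auto

lemma finite_free_vars: "finite (free_vars \<phi>)"
  by (induction \<phi>) (auto simp: finite_term_vars)

text \<open>A predicate reads a whole environment and carries no arity, so connectives and
  quantifiers can be treated without bookkeeping of free variables.\<close>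

definition definable_pred ::
  "('a::linordered_field, 'f, 'r) expansion \<Rightarrow> ((nat \<Rightarrow> 'a) \<Rightarrow> bool) \<Rightarrow> bool" where
  "definable_pred M P \<longleftrightarrow> (\<exists>\<phi>. wf_form M \<phi> \<and> (\<forall>e. sat M e \<phi> \<longleftrightarrow> P e))"

text \<open>Quantifying existentially over \<open>k\<close> together with the equation
  \<open>k = 0\<close> substitutes \<open>0\<close> for \<open>k\<close> and removes it from the
  free variables. In the application \<open>V\<close> consists of the free variables beyond the
  arity.\<close>

lemma sat_close:
  assumes "finite V" "wf_form M \<phi>"
  shows "\<exists>\<psi>. wf_form M \<psi> \<and> free_vars \<psi> = free_vars \<phi> - V \<and>
    (\<forall>e. sat M e \<psi> \<longleftrightarrow> sat M (\<lambda>i. if i \<in> V then 0 else e i) \<phi>)"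
  using assms
proof (induction V)
  case empty
  then show ?case by auto
next
  case (insert k V)
  then obtain \<psi> where \<psi>: "wf_form M \<psi>" "free_vars \<psi> = free_vars \<phi> - V"
      "\<And>e. sat M e \<psi> \<longleftrightarrow> sat M (\<lambda>i. if i \<in> V then 0 else e i) \<phi>"
    by auto
  define \<theta> where "\<theta> = Exist k (Conj (Equal (Var k) (Param 0)) \<psi>)"
  have "sat M e \<theta> \<longleftrightarrow> sat M (\<lambda>i. if i \<in> insert k V then 0 else e i) \<phi>" for e
  proof -
    have "sat M e \<theta> \<longleftrightarrow> sat M (e(k := 0)) \<psi>" by (simp add: \<theta>_def)
    also have "\<dots> \<longleftrightarrow> sat M (\<lambda>i. if i \<in> insert k V then 0 else e i) \<phi>"
      unfolding \<psi>(3) by (rule sat_cong) simp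
    finally show ?thesis .
  qed
  moreover have "wf_form M \<theta>" "free_vars \<theta> = free_vars \<phi> - insert k V"
    using \<psi>(1,2) by (auto simp: \<theta>_def)
  ultimately show ?case by blast
qed

text \<open>Coordinates beyond the arity are irrelevant, so they may be fixed to \<open>0\<close>.\<close>

lemma definable_iff_pred:
  "definable M n A \<longleftrightarrow>
    (\<forall>xs\<in>A. length xs = n) \<and> definable_pred M (\<lambda>e. map e [0..<n] \<in> A)"
proof safe
  assume "definable M n A"
  then obtain \<phi> where \<phi>: "wf_form M \<phi>" "free_vars \<phi> \<subseteq> {..<n}"
      "A = {xs. length xs = n \<and> sat M (\<lambda>i. xs ! i) \<phi>}"
    unfolding definable_def by auto
  have "sat M (\<lambda>i. map e [0..<n] ! i) \<phi> = sat M e \<phi>" for e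
    by (rule sat_cong) (use \<phi>(2) in auto)
  then show "definable_pred M (\<lambda>e. map e [0..<n] \<in> A)"
    unfolding definable_pred_def using \<phi> by auto
  show "length xs = n" if "xs \<in> A" for xs using that \<phi> by auto
next
  assume A: "\<forall>xs\<in>A. length xs = n" and "definable_pred M (\<lambda>e. map e [0..<n] \<in> A)"
  then obtain \<phi> where \<phi>: "wf_form M \<phi>" "\<And>e. sat M e \<phi> \<longleftrightarrow> map e [0..<n] \<in> A"
    unfolding definable_pred_def by auto
  obtain \<psi> where \<psi>: "wf_form M \<psi>" "free_vars \<psi> = free_vars \<phi> - (free_vars \<phi> - {..<n})"
    "\<And>e. sat M e \<psi> \<longleftrightarrow>
      sat M (\<lambda>i. if i \<in> free_vars \<phi> - {..<n} then 0 else e i) \<phi>"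
    using sat_close[of "free_vars \<phi> - {..<n}" M \<phi>] \<phi>(1) finite_free_vars by blast
  have "sat M (\<lambda>i. xs ! i) \<psi> \<longleftrightarrow> xs \<in> A" if "length xs = n" for xs
  proof -
    have "map (\<lambda>i. if i \<in> free_vars \<phi> - {..<n} then 0 else xs ! i) [0..<n] = xs"
      using that by (auto intro: nth_equalityI)
    then show ?thesis by (simp only: \<psi>(3) \<phi>(2))
  qed
  then show "definable M n A"
    unfolding definable_def using \<psi>(1,2) A by (intro exI[of _ \<psi>]) auto
qed

section \<open>Closure under connectives, quantifiers and substitution\<close>

lemma definable_pred_rename:
  assumes "definable_pred M P" "inj r"
  shows "definable_pred M (\<lambda>e. P (e \<circ> r))"
  using assms unfolding definable_pred_def
  by (metis sat_rename wf_rename_form)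

lemma definable_pred_not: "definable_pred M P \<Longrightarrow> definable_pred M (\<lambda>e. \<not> P e)"
  unfolding definable_pred_def by (metis sat.simps(4) wf_form.simps(4))

lemma definable_pred_conj:
  "definable_pred M P \<Longrightarrow> definable_pred M Q \<Longrightarrow> definable_pred M (\<lambda>e. P e \<and> Q e)"
  unfolding definable_pred_def by (metis sat.simps(5) wf_form.simps(5))

lemma definable_pred_disj:
  "definable_pred M P \<Longrightarrow> definable_pred M Q \<Longrightarrow> definable_pred M (\<lambda>e. P e \<or> Q e)"
  using definable_pred_not[OF definable_pred_conj[OF definable_pred_not definable_pred_not]]
  by fastforce

lemma definable_pred_imp:
  "definable_pred M P \<Longrightarrow> definable_pred M Q \<Longrightarrow> definable_pred M (\<lambda>e. P e \<longrightarrow> Q e)"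
  using definable_pred_disj[OF definable_pred_not] by fastforce

lemma definable_pred_iff:
  "definable_pred M P \<Longrightarrow> definable_pred M Q \<Longrightarrow> definable_pred M (\<lambda>e. P e \<longleftrightarrow> Q e)"
  unfolding iff_conv_conj_imp by (intro definable_pred_conj definable_pred_imp)

lemma definable_pred_const: "definable_pred M (\<lambda>e. C)"
proof (cases C)
  case True
  then show ?thesis
    unfolding definable_pred_def by (intro exI[of _ "Equal Zero Zero"]) auto
next
  case False
  then show ?thesis
    unfolding definable_pred_def by (intro exI[of _ "Less Zero Zero"]) auto
qed

text \<open>
  De Bruijn style: the bound variable becomes coordinate \<open>0\<close> and the environment is shifted.
  The permutation sends \<open>0\<close> to a fresh variable \<open>N\<close> and undoes the shift below \<open>N\<close>.
\<close>

lemma definable_pred_ex: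
  assumes "definable_pred M (\<lambda>e. Q (e 0) (\<lambda>n. e (Suc n)))"
  shows "definable_pred M (\<lambda>e. \<exists>x. Q x e)"
proof -
  obtain \<phi> where \<phi>: "wf_form M \<phi>" "\<And>e. sat M e \<phi> \<longleftrightarrow> Q (e 0) (\<lambda>n. e (Suc n))"
    using assms unfolding definable_pred_def by auto
  obtain N where N: "\<And>i. i \<in> free_vars \<phi> \<Longrightarrow> i \<le> N"
    using finite_free_vars[of \<phi>] unfolding finite_nat_set_iff_bounded_le by blast
  define r where "r i = (if i = 0 then N else if i \<le> N then i - 1 else i)" for i
  have "inj r" unfolding r_def inj_def by (auto split: if_splits)
  moreover have "sat M (e(N := x) \<circ> r) \<phi> \<longleftrightarrow> Q x e" for e x
  proof -
    have "sat M (e(N := x) \<circ> r) \<phi> = sat M (case_nat x e) \<phi>"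
      by (rule sat_cong) (auto simp: r_def split: nat.splits dest!: N)
    then show ?thesis by (simp add: \<phi>)
  qed
  ultimately show ?thesis
    unfolding definable_pred_def
    by (intro exI[of _ "Exist N (rename_form r \<phi>)"])
      (simp add: sat_rename wf_rename_form \<phi>(1))
qed

lemma definable_pred_all:
  assumes "definable_pred M (\<lambda>e. Q (e 0) (\<lambda>n. e (Suc n)))"
  shows "definable_pred M (\<lambda>e. \<forall>x. Q x e)"
  using definable_pred_not[OF definable_pred_ex[of M "\<lambda>x e. \<not> Q x e"]]
    definable_pred_not[OF assms] by simp

text \<open>This is definability of the graph, with the value at coordinate \<open>0\<close> and the
  argument shifted behind it. A map need not be given by a term, so a function known only through a
  definable graph can still be nested inside conditions.\<close>

definition definable_map ::
  "('a::linordered_field, 'f, 'r) expansion \<Rightarrow> ((nat \<Rightarrow> 'a) \<Rightarrow> 'a) \<Rightarrow> bool" where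
  "definable_map M t \<longleftrightarrow> definable_pred M (\<lambda>e. e 0 = t (\<lambda>n. e (Suc n)))"

lemma definable_map_var: "definable_map M (\<lambda>e. e i)"
  unfolding definable_map_def definable_pred_def
  by (intro exI[of _ "Equal (Var 0) (Var (Suc i))"]) auto

lemma definable_map_const: "definable_map M (\<lambda>e. c)"
  unfolding definable_map_def definable_pred_def
  by (intro exI[of _ "Equal (Var 0) (Param c)"]) auto

text \<open>Needed to move \<open>t\<close> under a quantifier, whose bound variable occupies
  coordinate \<open>0\<close>. In the graph of \<open>t\<close> the renaming keeps the value at
  \<open>0\<close> and frees coordinate \<open>1\<close>.\<close>

lemma definable_map_shift:
  assumes "definable_map M t"
  shows "definable_map M (\<lambda>e. t (\<lambda>n. e (Suc n)))"
proof -
  have "inj (case_nat 0 (\<lambda>n. Suc (Suc n)))"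
    by (auto simp: inj_def split: nat.splits)
  from definable_pred_rename[OF assms[unfolded definable_map_def] this]
  show ?thesis by (simp add: definable_map_def comp_def)
qed

text \<open>As \<open>t\<close> need not be a term, it is substituted through its graph: there is an
  \<open>x\<close> equal to \<open>t e\<close> that satisfies \<open>P x e\<close>.\<close>

lemma definable_pred_subst:
  assumes "definable_pred M (\<lambda>e. P (e 0) (\<lambda>n. e (Suc n)))" "definable_map M t"
  shows "definable_pred M (\<lambda>e. P (t e) e)"
proof -
  have "definable_pred M (\<lambda>e. \<exists>x. x = t e \<and> P x e)"
    using assms by (intro definable_pred_ex definable_pred_conj) (auto simp: definable_map_def)
  then show ?thesis by simp
qed

lemma definable_pred_apply:
  assumes "definable_pred M (\<lambda>e. P (e 0))" "definable_map M t"
  shows "definable_pred M (\<lambda>e. P (t e))"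
  using definable_pred_subst[of M "\<lambda>x e. P x"] assms by simp

lemma definable_pred_apply2:
  assumes "definable_pred M (\<lambda>e. R (e 0) (e 1))" "definable_map M t" "definable_map M u"
  shows "definable_pred M (\<lambda>e. R (t e) (u e))"
proof (rule definable_pred_subst[OF _ assms(3), where P = "\<lambda>y e. R (t e) y"])
  have "definable_pred M (\<lambda>e. R (e 0) (e (Suc 0)))" using assms(1) by simp
  then show "definable_pred M (\<lambda>e. R (t (\<lambda>n. e (Suc n))) (e 0))"
    by (intro definable_pred_subst[OF _ definable_map_shift[OF assms(2)],
          where P = "\<lambda>x e. R x (e 0)"])
qed

lemma definable_map_apply:
  assumes "definable_pred M (\<lambda>e. e 1 = g (e 0))" "definable_map M t"
  shows "definable_map M (\<lambda>e. g (t e))"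
  unfolding definable_map_def
  using definable_pred_subst[OF _ definable_map_shift[OF assms(2)], where P = "\<lambda>x e. e 0 = g x"]
    assms(1) by simp

lemma definable_map_apply2:
  assumes "definable_pred M (\<lambda>e. e 2 = g (e 1) (e 0))" "definable_map M t" "definable_map M u"
  shows "definable_map M (\<lambda>e. g (t e) (u e))"
  unfolding definable_map_def
proof (rule definable_pred_subst[OF _ definable_map_shift[OF assms(2)],
      where P = "\<lambda>x e. e 0 = g x (u (\<lambda>n. e (Suc n)))"])
  have "definable_pred M (\<lambda>e. e (Suc (Suc 0)) = g (e (Suc 0)) (e 0))"
    using assms(1) by (simp add: numeral_2_eq_2)
  then show "definable_pred M (\<lambda>e. e (Suc 0) = g (e 0) (u (\<lambda>n. e (Suc (Suc n)))))"
    by (intro definable_pred_subst[OF _ definable_map_shift[OF definable_map_shift[OF assms(3)]],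
          where P = "\<lambda>y e. e (Suc 0) = g (e 0) y"])
qed

lemma definable_map_uminus: "definable_map M t \<Longrightarrow> definable_map M (\<lambda>e. - t e)"
  by (rule definable_map_apply)
    (auto simp: definable_pred_def intro!: exI[of _ "Equal (Var 1) (Uminus (Var 0))"])

lemma definable_map_plus:
  "definable_map M t \<Longrightarrow> definable_map M u \<Longrightarrow> definable_map M (\<lambda>e. t e + u e)"
  by (rule definable_map_apply2)
    (auto simp: definable_pred_def intro!: exI[of _ "Equal (Var 2) (Plus (Var 1) (Var 0))"])

lemma definable_map_times:
  "definable_map M t \<Longrightarrow> definable_map M u \<Longrightarrow> definable_map M (\<lambda>e. t e * u e)"
  by (rule definable_map_apply2)
    (auto simp: definable_pred_def intro!: exI[of _ "Equal (Var 2) (Times (Var 1) (Var 0))"])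

lemma definable_pred_eq:
  "definable_map M t \<Longrightarrow> definable_map M u \<Longrightarrow> definable_pred M (\<lambda>e. t e = u e)"
  by (rule definable_pred_apply2)
    (auto simp: definable_pred_def intro!: exI[of _ "Equal (Var 0) (Var 1)"])

lemma definable_pred_less:
  "definable_map M t \<Longrightarrow> definable_map M u \<Longrightarrow> definable_pred M (\<lambda>e. t e < u e)"
  by (rule definable_pred_apply2)
    (auto simp: definable_pred_def intro!: exI[of _ "Less (Var 0) (Var 1)"])

lemma definable_pred_le:
  "definable_map M t \<Longrightarrow> definable_map M u \<Longrightarrow> definable_pred M (\<lambda>e. t e \<le> u e)"
  unfolding not_less[symmetric] by (intro definable_pred_not definable_pred_less)

text \<open>With these rules definability is read off the shape of a HOL condition. They treat
  unbounded quantifiers only, which is why the definitions below write bounds as premises or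
  conjuncts under the quantifier.\<close>

lemmas definable_intros =
  definable_pred_not definable_pred_conj definable_pred_disj definable_pred_imp
  definable_pred_iff definable_pred_ex definable_pred_all definable_pred_eq definable_pred_less
  definable_pred_le definable_map_var definable_map_const definable_map_uminus
  definable_map_plus definable_map_times

section \<open>Definable sets and functions of one variable\<close>

lemma definable_set_iff_pred: "definable_set M X \<longleftrightarrow> definable_pred M (\<lambda>e. e 0 \<in> X)"
  unfolding definable_set_def definable_iff_pred by (auto simp: image_iff)

lemma definable_fun_on_iff_pred:
  "definable_fun_on M X f \<longleftrightarrow> definable_pred M (\<lambda>e. e 0 \<in> X \<and> e 1 = f (e 0))"
proof -
  have "map e [0..<2] \<in> (\<lambda>x. [x, f x]) ` X \<longleftrightarrow> e 0 \<in> X \<and> e 1 = f (e 0)" for e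
    by (auto simp: image_iff numeral_2_eq_2)
  then show ?thesis
    unfolding definable_fun_on_def definable_iff_pred by auto
qed

lemma definable_set_Collect: "definable_pred M (\<lambda>e. P (e 0)) \<Longrightarrow> definable_set M {x. P x}"
  by (simp add: definable_set_iff_pred)

lemma definable_pred_mem:
  "definable_set M X \<Longrightarrow> definable_map M t \<Longrightarrow> definable_pred M (\<lambda>e. t e \<in> X)"
  by (rule definable_pred_apply) (simp add: definable_set_iff_pred)

lemma definable_set_ext_interval: "definable_set M (ext_interval a b)"
proof -
  have "definable_pred M (\<lambda>e. a < Fin (e 0))"
    by (cases a) (simp_all add: definable_pred_less definable_map_var definable_map_const
        definable_pred_const)
  moreover have "definable_pred M (\<lambda>e. Fin (e 0) < b)"
    by (cases b) (simp_all add: definable_pred_less definable_map_var definable_map_const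
        definable_pred_const)
  ultimately show ?thesis
    unfolding ext_interval_def by (intro definable_set_Collect definable_pred_conj)
qed

section \<open>Definable sets without interior\<close>

locale tame_field =
  fixes M :: "('a::{linordered_field, linorder_topology}, 'f, 'r) expansion"
  assumes complete: "definably_complete M" and locally_omin: "locally_o_minimal M"
begin

definition thin :: "'a set \<Rightarrow> bool" where
  "thin X \<longleftrightarrow> definable_set M X \<and> (\<forall>u v. u < v \<longrightarrow> \<not> {u<..<v} \<subseteq> X)"

lemma thin_definable: "thin X \<Longrightarrow> definable_set M X"
  and thin_no_interval: "thin X \<Longrightarrow> u < v \<Longrightarrow> \<not> {u<..<v} \<subseteq> X"
  by (simp_all add: thin_def)

lemma thin_subset: "thin X \<Longrightarrow> Y \<subseteq> X \<Longrightarrow> definable_set M Y \<Longrightarrow> thin Y"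
  unfolding thin_def by blast

lemma not_thin_imp_interval:
  "definable_set M X \<Longrightarrow> \<not> thin X \<Longrightarrow> \<exists>u v. u < v \<and> {u<..<v} \<subseteq> X"
  unfolding thin_def by blast

lemma definable_set_uminus: "definable_set M X \<Longrightarrow> definable_set M {t. - t \<in> X}"
  by (intro definable_set_Collect definable_pred_mem definable_intros)

text \<open>Local o-minimality is applied to the indicator function of \<open>X\<close>, whose sign
  to the right of \<open>x\<close> is eventually constant.\<close>

lemma ex_right_interval:
  assumes X: "definable_set M X"
  shows "\<exists>y>x. {x<..<y} \<subseteq> X \<or> {x<..<y} \<inter> X = {}"
proof -
  define g :: "'a \<Rightarrow> 'a" where "g t = (if t \<in> X then 1 else 0)" for t
  have "definable_pred M (\<lambda>e. e 0 \<in> X \<and> e 1 = 1 \<or> \<not> e 0 \<in> X \<and> e 1 = 0)"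
    by (intro definable_intros definable_pred_mem[OF X])
  moreover have "(e 0 \<in> X \<and> e 1 = 1 \<or> \<not> e 0 \<in> X \<and> e 1 = 0) \<longleftrightarrow>
      e 0 \<in> UNIV \<and> e 1 = g (e 0)" for e :: "nat \<Rightarrow> 'a"
    by (auto simp: g_def)
  ultimately have "definable_fun_on M UNIV g" by (simp add: definable_fun_on_iff_pred)
  then obtain y where "y > x" and y: "(\<forall>t\<in>{x<..<y}. g t > 0) \<or>
      (\<forall>t\<in>{x<..<y}. g t = 0) \<or> (\<forall>t\<in>{x<..<y}. g t < 0)"
    using locally_omin unfolding locally_o_minimal_def by blast
  have "{x<..<y} \<subseteq> X \<or> {x<..<y} \<inter> X = {}"
    using y by (auto simp: g_def split: if_splits)
  with \<open>y > x\<close> show ?thesis by blast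
qed

text \<open>Local o-minimality speaks of right neighbourhoods; the reflection
  \<open>t \<mapsto> - t\<close> turns them into left ones.\<close>

lemma ex_left_interval:
  assumes X: "definable_set M X"
  shows "\<exists>y<x. {y<..<x} \<subseteq> X \<or> {y<..<x} \<inter> X = {}"
proof -
  obtain y where y: "y > - x"
    "{-x<..<y} \<subseteq> {t. - t \<in> X} \<or> {-x<..<y} \<inter> {t. - t \<in> X} = {}"
    using ex_right_interval[OF definable_set_uminus[OF X]] by blast
  have flip: "t \<in> {-y<..<x} \<longleftrightarrow> - t \<in> {-x<..<y}" for t by auto
  have "{-y<..<x} \<subseteq> X \<or> {-y<..<x} \<inter> X = {}"
    using y(2) flip by fastforce
  then show ?thesis using y(1) by (intro exI[of _ "- y"]) auto
qed

text \<open>On each side of \<open>x\<close> the set either fills a small interval, which thinness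
  forbids, or misses one. The point \<open>x\<close> may lie inside or outside \<open>X\<close>, so
  this yields discreteness as well as closedness.\<close>

lemma thin_isolated:
  assumes "thin X"
  shows "\<exists>u v. u < x \<and> x < v \<and> {u<..<v} \<inter> X \<subseteq> {x}"
proof -
  obtain u where u: "u < x" "{u<..<x} \<subseteq> X \<or> {u<..<x} \<inter> X = {}"
    using ex_left_interval thin_definable[OF assms] by blast
  obtain v where v: "v > x" "{x<..<v} \<subseteq> X \<or> {x<..<v} \<inter> X = {}"
    using ex_right_interval thin_definable[OF assms] by blast
  have "{u<..<x} \<inter> X = {}" "{x<..<v} \<inter> X = {}"
    using u v thin_no_interval[OF assms] by blast+
  moreover have "{u<..<v} \<subseteq> {u<..<x} \<union> {x} \<union> {x<..<v}" by auto
  ultimately have "{u<..<v} \<inter> X \<subseteq> {x}" by blast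
  with u(1) v(1) show ?thesis by blast
qed

lemma thin_uminus:
  assumes "thin X"
  shows "thin {t. - t \<in> X}"
  unfolding thin_def
proof (intro conjI allI impI notI)
  show "definable_set M {t. - t \<in> X}"
    using assms thin_definable definable_set_uminus by blast
  fix u v :: 'a
  assume uv: "u < v" "{u<..<v} \<subseteq> {t. - t \<in> X}"
  have "t \<in> X" if "t \<in> {-v<..<-u}" for t
  proof -
    have "- t \<in> {u<..<v}" using that by auto
    then show ?thesis using uv(2) by auto
  qed
  then show False using thin_no_interval[OF assms, of "-v" "-u"] uv(1) by auto
qed

text \<open>The behaviour at infinity is that of the set of reciprocals at \<open>0\<close>.\<close>

lemma thin_bounded_above:
  assumes "thin X"
  shows "\<exists>B. \<forall>x\<in>X. x < B"
proof -
  \<comment> \<open>Division is not a symbol of the language, so reciprocals are described by a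
    product.\<close>
  define Y where "Y = {t. \<exists>s. s \<in> X \<and> s * t = 1}"
  have "definable_set M Y"
    unfolding Y_def
    by (intro definable_set_Collect definable_intros definable_pred_mem
        thin_definable[OF assms])
  then obtain y where y: "y > 0" "{0<..<y} \<subseteq> Y \<or> {0<..<y} \<inter> Y = {}"
    using ex_right_interval by blast
  have inv: "0 < s \<and> 1 / s \<in> {0<..<y}" if "1 / y < s" for s
  proof -
    have "0 < s" using that y(1) by (meson less_trans zero_less_divide_1_iff)
    then show ?thesis using that y(1) by (simp add: field_simps)
  qed
  have mem: "s \<in> X \<longleftrightarrow> 1 / s \<in> Y" if "1 / y < s" for s
    using inv[OF that] unfolding Y_def by (auto simp: field_simps)
  have "\<not> {0<..<y} \<subseteq> Y"
  proof
    assume "{0<..<y} \<subseteq> Y"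
    then have "s \<in> X" if "1 / y < s" for s using inv[OF that] mem[OF that] by blast
    then have "{1 / y<..<1 / y + 1} \<subseteq> X" by auto
    then show False using thin_no_interval[OF assms, of "1 / y" "1 / y + 1"] by simp
  qed
  then have disj: "{0<..<y} \<inter> Y = {}" using y(2) by blast
  have "s < 1 / y + 1" if "s \<in> X" for s
  proof -
    have "\<not> 1 / y < s" using that disj inv[of s] mem[of s] by blast
    then show ?thesis by (simp add: not_less less_add_one le_less_trans)
  qed
  then show ?thesis by blast
qed

text \<open>The element of \<open>X\<close> and the bound \<open>B\<close> keep the supremum in the
  extended order away from both infinities.\<close>

lemma definable_supremum:
  assumes "definable_set M X" "x \<in> X" "\<And>x. x \<in> X \<Longrightarrow> x \<le> B"
  shows "\<exists>s. (\<forall>x\<in>X. x \<le> s) \<and> (\<forall>u<s. \<exists>x\<in>X. u < x)"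
proof -
  obtain s where s: "\<forall>x\<in>X. Fin x \<le> s" "\<And>u. (\<forall>x\<in>X. Fin x \<le> u) \<longrightarrow> s \<le> u"
    using complete assms(1) unfolding definably_complete_def by blast
  have "s \<le> Fin B" using s(2)[of "Fin B"] assms(3) by simp
  moreover have "Fin x \<le> s" using s(1) assms(2) by blast
  ultimately obtain c where c: "s = Fin c" by (cases s) auto
  have "\<exists>x\<in>X. u < x" if "u < c" for u
    using s(2)[of "Fin u"] that unfolding c by (auto simp: not_le)
  then show ?thesis using s(1) unfolding c by auto
qed

text \<open>Elements of \<open>X\<close> come arbitrarily close to the supremum \<open>s\<close>
  from below, but near \<open>s\<close> the set \<open>X\<close> can contain no point other than
  \<open>s\<close>; hence \<open>s\<close> itself belongs to \<open>X\<close>.\<close>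

lemma thin_max:
  assumes "thin X" "X \<noteq> {}"
  shows "\<exists>m\<in>X. \<forall>x\<in>X. x \<le> m"
proof -
  obtain B where "\<forall>x\<in>X. x < B" using thin_bounded_above[OF assms(1)] by blast
  then obtain s where s: "\<forall>x\<in>X. x \<le> s" "\<And>u. u < s \<Longrightarrow> \<exists>x\<in>X. u < x"
    using definable_supremum[OF thin_definable[OF assms(1)]] assms(2)
    by (metis all_not_in_conv less_imp_le)
  obtain u v where uv: "u < s" "s < v" "{u<..<v} \<inter> X \<subseteq> {s}"
    using thin_isolated[OF assms(1)] by blast
  obtain x where "x \<in> X" "u < x" using s(2) uv(1) by blast
  moreover have "x < v" using s(1) \<open>x \<in> X\<close> uv(2) by force
  ultimately have "s \<in> X" using uv(3) by auto
  then show ?thesis using s(1) by blast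
qed

lemma thin_min:
  assumes "thin X" "X \<noteq> {}"
  shows "\<exists>m\<in>X. \<forall>x\<in>X. m \<le> x"
proof -
  have "{t. - t \<in> X} \<noteq> {}" using assms(2) by (metis (mono_tags) add.inverse_inverse empty_iff
        equals0I mem_Collect_eq)
  then obtain m where m: "- m \<in> X" "\<And>x. - x \<in> X \<Longrightarrow> x \<le> m"
    using thin_max[OF thin_uminus[OF assms(1)]] by auto
  have "- m \<le> x" if "x \<in> X" for x
    using m(2)[of "- x"] that by simp
  with m(1) show ?thesis by blast
qed

lemma thin_pseudo_finite:
  assumes "thin X"
  shows "pseudo_finite M X"
  unfolding pseudo_finite_def
proof (intro conjI)
  show "definable_set M X" using assms by (rule thin_definable)
  show "closed X"
    unfolding closed_def
  proof (rule topological_space_class.openI)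
    fix x assume "x \<in> - X"
    obtain u v where "u < x" "x < v" "{u<..<v} \<inter> X \<subseteq> {x}"
      using thin_isolated[OF assms] by blast
    with \<open>x \<in> - X\<close> show "\<exists>T. open T \<and> x \<in> T \<and> T \<subseteq> - X"
      by (intro exI[of _ "{u<..<v}"]) auto
  qed
  show "bdd_above X"
    using thin_max[OF assms] by (metis bdd_above.I bdd_above_empty)
  show "bdd_below X"
    using thin_min[OF assms] by (metis bdd_below.I bdd_below_empty)
  show "discrete X"
  proof (rule discreteI)
    fix x assume "x \<in> X"
    obtain u v where "u < x" "x < v" "{u<..<v} \<inter> X \<subseteq> {x}"
      using thin_isolated[OF assms] by blast
    with \<open>x \<in> X\<close> show "x isolated_in X"
      unfolding isolated_in_def by (intro conjI exI[of _ "{u<..<v}"]) auto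
  qed
qed

text \<open>Just to the right of \<open>u\<close> the set \<open>X\<close> fills an interval or
  misses one, and an interval missed by \<open>X\<close> must be filled by \<open>Y\<close>.\<close>

lemma interval_subset_Un:
  assumes X: "definable_set M X" and "u < v" "{u<..<v} \<subseteq> X \<union> Y"
  shows "\<exists>u' v'. u \<le> u' \<and> u' < v' \<and> v' \<le> v \<and> ({u'<..<v'} \<subseteq> X \<or> {u'<..<v'} \<subseteq> Y)"
proof -
  obtain y where y: "y > u" "{u<..<y} \<subseteq> X \<or> {u<..<y} \<inter> X = {}"
    using ex_right_interval[OF X] by blast
  have "{u<..<min y v} \<subseteq> {u<..<y} \<inter> {u<..<v}" by auto
  then have "{u<..<min y v} \<subseteq> X \<or> {u<..<min y v} \<subseteq> Y"
    using y(2) assms(3) by blast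
  then show ?thesis using y(1) assms(2)
    by (intro exI[of _ u] exI[of _ "min y v"]) auto
qed

text \<open>If an interval is cut into two halves, one of them avoids \<open>x\<close> and would
  have to lie in \<open>X\<close>.\<close>

lemma thin_insert:
  assumes "thin X"
  shows "thin (insert x X)"
  unfolding thin_def
proof (intro conjI allI impI notI)
  have "insert x X = {t. t = x \<or> t \<in> X}" by auto
  then show "definable_set M (insert x X)"
    by (simp only:) (intro definable_set_Collect definable_intros definable_pred_mem
        thin_definable[OF assms])
  fix u v :: 'a
  assume uv: "u < v" "{u<..<v} \<subseteq> insert x X"
  obtain w where w: "u < w" "w < v" using dense uv(1) by blast
  have "{u<..<w} \<subseteq> X \<or> {w<..<v} \<subseteq> X"
  proof (cases "x < w")
    case True
    then have "x \<notin> {w<..<v}" "{w<..<v} \<subseteq> {u<..<v}" using w by auto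
    then show ?thesis using uv(2) by blast
  next
    case False
    then have "x \<notin> {u<..<w}" "{u<..<w} \<subseteq> {u<..<v}" using w by auto
    then show ?thesis using uv(2) by blast
  qed
  then show False using thin_no_interval[OF assms] w by blast
qed

section \<open>Images of thin sets under definable functions\<close>

abbreviation definable_fun :: "('a \<Rightarrow> 'a) \<Rightarrow> bool" where
  "definable_fun g \<equiv> definable_pred M (\<lambda>e. e 1 = g (e 0))"

lemma definable_set_image:
  assumes "definable_set M D" "definable_fun g"
  shows "definable_set M (g ` D)"
proof -
  have "g ` D = {y. \<exists>d. d \<in> D \<and> y = g d}" by auto
  then show ?thesis
    by (simp only:) (intro definable_set_Collect definable_intros definable_pred_mem[OF assms(1)]
        definable_map_apply[OF assms(2)])
qed

text \<open>
  Induction along \<open>D\<close>: consider the least \<open>d\<close> for which the image of \<open>D \<inter> {..d}\<close> has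
  interior, and its predecessor in \<open>D\<close>.
\<close>

lemma thin_image:
  assumes D: "thin D" and g: "definable_fun g"
  shows "thin (g ` D)"
proof (rule ccontr)
  assume not_thin: "\<not> thin (g ` D)"
  define S where "S = {d. d \<in> D \<and> \<not> thin (g ` (D \<inter> {..d}))}"
  have dD: "definable_set M D" using D by (rule thin_definable)
  have dcut: "definable_set M (D \<inter> {..d})" for d
    unfolding Int_def atMost_def mem_Collect_eq
    by (intro definable_set_Collect definable_intros definable_pred_mem[OF dD])
  \<comment> \<open>The images are definable in any case, so thinness reduces to the absence of
    intervals. This is a first-order condition on \<open>d\<close>, which makes \<open>S\<close>
    definable.\<close>
  have thin_iff: "thin (g ` (D \<inter> {..d})) \<longleftrightarrow>
      \<not> (\<exists>u v. u < v \<and> (\<forall>y. u < y \<and> y < v \<longrightarrow> (\<exists>c. c \<in> D \<and> c \<le> d \<and> y = g c)))" for d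
  proof -
    have "{u<..<v} \<subseteq> g ` (D \<inter> {..d}) \<longleftrightarrow>
        (\<forall>y. u < y \<and> y < v \<longrightarrow> (\<exists>c. c \<in> D \<and> c \<le> d \<and> y = g c))" for u v
      by (simp add: subset_iff image_iff Bex_def conj_assoc)
    then show ?thesis unfolding thin_def using definable_set_image[OF dcut g] by blast
  qed
  have "definable_set M S"
    unfolding S_def thin_iff
    by (intro definable_set_Collect definable_intros definable_pred_mem[OF dD]
        definable_map_apply[OF g])
  moreover have "S \<subseteq> D" unfolding S_def by blast
  ultimately have "thin S" by (intro thin_subset[OF D])
  have "D \<noteq> {}" using not_thin D by auto
  then obtain m where "m \<in> D" "\<forall>d\<in>D. d \<le> m" using thin_max[OF D] by blast
  \<comment> \<open>For the maximum \<open>m\<close> the set \<open>D \<inter> {..m}\<close> is all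
    of \<open>D\<close>, so \<open>S\<close> is nonempty.\<close>
  then have "m \<in> S" unfolding S_def using not_thin by (simp add: Int_absorb2 subset_iff)
  then obtain d where d: "d \<in> S" "\<forall>c\<in>S. d \<le> c" using thin_min[OF \<open>thin S\<close>] by blast
  define C where "C = {c. c \<in> D \<and> c < d}"
  have "definable_set M C"
    unfolding C_def by (intro definable_set_Collect definable_intros definable_pred_mem[OF dD])
  moreover have "C \<subseteq> D" unfolding C_def by blast
  ultimately have "thin C" by (intro thin_subset[OF D])
  have "thin (g ` C)"
  proof (cases "C = {}")
    case True
    then show ?thesis using \<open>thin C\<close> by simp
  next
    case False
    then obtain c where c: "c \<in> C" "\<forall>x\<in>C. x \<le> c" using thin_max[OF \<open>thin C\<close>] by blast
    then have "C = D \<inter> {..c}" unfolding C_def by auto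
    moreover have "c \<notin> S" using c(1) d(2) unfolding C_def by auto
    ultimately show ?thesis using c(1) unfolding S_def C_def by auto
  qed
  then have "thin (insert (g d) (g ` C))" by (rule thin_insert)
  moreover have "D \<inter> {..d} = insert d C"
    using d(1) unfolding S_def C_def by auto
  ultimately show False using d(1) unfolding S_def by simp
qed

text \<open>The inverse of \<open>g\<close> on \<open>g\<close>
  X\<open>, extended by\<close>0\<open>, has a definable graph, and it maps the thin set\<close>g
  \<open>X\<close> back onto \<open>X\<close>.\<close>

lemma thin_inj_image:
  assumes X: "definable_set M X" and g: "definable_fun g" and "inj_on g X" "thin (g ` X)"
  shows "thin X"
proof -
  define h where "h y = (if y \<in> g ` X then the_inv_into X g y else 0)" for y
  have h_eq: "(e 1 \<in> X \<and> e 0 = g (e 1) \<or> \<not> (\<exists>x. x \<in> X \<and> e 0 = g x) \<and> e 1 = 0) \<longleftrightarrow>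
      e 1 = h (e 0)" for e :: "nat \<Rightarrow> 'a"
    unfolding h_def using assms(3) the_inv_into_f_f[OF assms(3)] by fastforce
  have "definable_pred M (\<lambda>e. e 1 \<in> X \<and> e 0 = g (e 1) \<or>
      \<not> (\<exists>x. x \<in> X \<and> e 0 = g x) \<and> e 1 = 0)"
    by (intro definable_intros definable_pred_mem[OF X] definable_map_apply[OF g])
  then have "definable_fun h" unfolding h_eq .
  moreover have "h ` g ` X = X"
    unfolding h_def using the_inv_into_f_f[OF assms(3)] by (force simp: image_image)
  ultimately show ?thesis using thin_image[OF assms(4)] by fastforce
qed

section \<open>Uniformity on subintervals\<close>

text \<open>
  Take \<open>\<delta> x\<close> to be the supremum of the admissible radii at \<open>x\<close>. If all sets \<open>{r \<le> \<delta>}\<close> were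
  thin, then so would be their images under \<open>\<delta>\<close>, hence the whole image of \<open>\<delta>\<close>; but then
  \<open>\<delta>\<close> attains a positive minimum.
\<close>

lemma uniform_radius:
  assumes R: "definable_pred M (\<lambda>e. R (e 0) (e 1))" and uv: "u < v"
    and ex: "\<And>x. u < x \<Longrightarrow> x < v \<Longrightarrow> \<exists>r>0. R x r"
    and anti: "\<And>x r s. R x r \<Longrightarrow> 0 < s \<Longrightarrow> s \<le> r \<Longrightarrow> R x s"
  shows "\<exists>r>0. \<exists>u' v'. u \<le> u' \<and> u' < v' \<and> v' \<le> v \<and> (\<forall>x. u' < x \<and> x < v' \<longrightarrow> R x r)"
proof -
  note defR = definable_pred_apply2[OF R]
  \<comment> \<open>\<open>D x d\<close> says that \<open>d\<close> is the supremum of the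
    admissible radii that are at most \<open>1\<close>; the cap keeps it finite. Whether
    \<open>R x d\<close> holds for \<open>d\<close> itself is left open.\<close>
  define D where "D x d \<longleftrightarrow> 0 < d \<and> d \<le> 1 \<and> (\<forall>s. 0 < s \<and> s < d \<longrightarrow> R x s) \<and>
    (\<forall>s. d < s \<and> s \<le> 1 \<longrightarrow> \<not> R x s)" for x d
  have defD: "definable_pred M (\<lambda>e. D (e 0) (e 1))"
    unfolding D_def by (intro definable_intros defR)
  have D_ex: "\<exists>d. D x d" if x: "u < x" "x < v" for x
  proof -
    define X where "X = {s. 0 < s \<and> s \<le> 1 \<and> R x s}"
    have defX: "definable_set M X"
      unfolding X_def by (intro definable_set_Collect definable_intros defR)
    obtain r where r: "r > 0" "R x r" using ex x by blast
    then have r_in: "min r 1 \<in> X" unfolding X_def using anti[of x r "min r 1"] by auto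
    have "\<exists>d. (\<forall>s\<in>X. s \<le> d) \<and> (\<forall>s<d. \<exists>t\<in>X. s < t)"
      using defX r_in by (rule definable_supremum[where B = 1]) (simp add: X_def)
    then obtain d where d: "\<forall>s\<in>X. s \<le> d" "\<And>s. s < d \<Longrightarrow> \<exists>t\<in>X. s < t"
      by blast
    have "min r 1 \<le> d" "0 < min r 1" using d(1) r_in r(1) by auto
    then have "0 < d" by (rule less_le_trans[rotated])
    moreover have "d \<le> 1"
    proof (rule ccontr)
      assume "\<not> d \<le> 1"
      then obtain t where "t \<in> X" "1 < t" using d(2)[of 1] by (auto simp: not_le)
      then show False unfolding X_def by auto
    qed
    moreover have "R x s" if s: "0 < s" "s < d" for s
    proof -
      obtain t where "t \<in> X" "s < t" using d(2) s(2) by blast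
      then show ?thesis using anti[of x t s] s(1) unfolding X_def by auto
    qed
    moreover have "\<not> R x s" if s: "d < s" "s \<le> 1" for s
    proof
      assume "R x s"
      then have "s \<in> X" using s \<open>0 < d\<close> unfolding X_def by auto
      then show False using d(1) s(1) by auto
    qed
    ultimately show ?thesis unfolding D_def by blast
  qed
  have D_less: "\<not> d < d'" if "D x d" "D x d'" for x d d'
  proof
    assume "d < d'"
    then obtain s where "d < s" "s < d'" using dense by blast
    then show False using that unfolding D_def by force
  qed
  have D_unique: "d = d'" if "D x d" "D x d'" for x d d'
    using D_less[OF that] D_less[OF that(2,1)] by auto
  \<comment> \<open>The value \<open>1\<close> outside the interval is arbitrary and only makes the
    function total: the sets \<open>X r\<close> below look at points of the interval alone.\<close>
  define \<delta> where "\<delta> x = (if u < x \<and> x < v then THE d. D x d else 1)" for x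
  have D_\<delta>: "D x (\<delta> x)" if x: "u < x" "x < v" for x
  proof -
    obtain d where d: "D x d" using D_ex[OF x] by blast
    then have "(THE d. D x d) = d" using D_unique by blast
    then show ?thesis using x d by (simp add: \<delta>_def)
  qed
  have \<delta>_eq: "((u < e 0 \<and> e 0 < v) \<and> D (e 0) (e 1) \<or> \<not> (u < e 0 \<and> e 0 < v) \<and> e 1 = 1) \<longleftrightarrow>
      e 1 = \<delta> (e 0)" for e :: "nat \<Rightarrow> 'a"
    using D_\<delta> D_unique by (cases "u < e 0 \<and> e 0 < v") (auto simp: \<delta>_def)
  have "definable_pred M (\<lambda>e. (u < e 0 \<and> e 0 < v) \<and> D (e 0) (e 1) \<or>
      \<not> (u < e 0 \<and> e 0 < v) \<and> e 1 = 1)"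
    by (intro definable_intros definable_pred_apply2[OF defD])
  then have def\<delta>: "definable_fun \<delta>" unfolding \<delta>_eq .
  define X where "X r = {x. u < x \<and> x < v \<and> r \<le> \<delta> x}" for r
  have defX: "definable_set M (X r)" for r
    unfolding X_def by (intro definable_set_Collect definable_intros definable_map_apply[OF def\<delta>])
  have "\<exists>r>0. \<not> thin (X r)"
  proof (rule ccontr)
    assume "\<not> (\<exists>r>0. \<not> thin (X r))"
    then have thinX: "thin (X r)" if "r > 0" for r using that by blast
    define E where "E = \<delta> ` {u<..<v}"
    have E_pos: "0 < y" if "y \<in> E" for y
      using that D_\<delta> unfolding E_def D_def by auto
    have "{u<..<v} = {x. u < x \<and> x < v}" by auto
    then have "definable_set M {u<..<v}"
      by (simp only:) (intro definable_set_Collect definable_intros)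
    then have "definable_set M E" unfolding E_def by (rule definable_set_image[OF _ def\<delta>])
    have "thin E"
    proof (rule ccontr)
      assume "\<not> thin E"
      then obtain p q where pq: "p < q" "{p<..<q} \<subseteq> E"
        using not_thin_imp_interval[OF \<open>definable_set M E\<close>] by blast
      \<comment> \<open>Values of \<delta> above \<open>m\<close> are attained on
        \<open>X m\<close>, so the image of this thin set would contain
        \<open>{m<..<q}\<close>.\<close>
      then obtain m where m: "p < m" "m < q" using dense by blast
      then have "0 < m" using pq(2) E_pos by auto
      have "y \<in> \<delta> ` X m" if "y \<in> {m<..<q}" for y
      proof -
        have "y \<in> E" using that m pq(2) by auto
        then show ?thesis using that unfolding E_def X_def by auto
      qed
      then show False
        using thin_no_interval[OF thin_image[OF thinX[OF \<open>0 < m\<close>] def\<delta>] m(2)] by blast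
    qed
    moreover obtain w where "u < w" "w < v" using dense uv by blast
    then have "E \<noteq> {}" unfolding E_def by auto
    ultimately obtain m where m: "m \<in> E" "\<forall>y\<in>E. m \<le> y" using thin_min by blast
    then have "{u<..<v} \<subseteq> X m" unfolding E_def X_def by auto
    then show False using thin_no_interval[OF thinX[OF E_pos[OF m(1)]] uv] by blast
  qed
  then obtain r where r: "r > 0" "\<not> thin (X r)" by blast
  then obtain u' v' where uv': "u' < v'" "{u'<..<v'} \<subseteq> X r"
    using not_thin_imp_interval[OF defX] by blast
  have le: "u \<le> u'"
  proof (rule ccontr)
    assume "\<not> u \<le> u'"
    then have "u' < min u v'" using uv'(1) by auto
    then obtain w where "u' < w" "w < min u v'" using dense by blast
    then have "w \<in> X r" "w < u" using uv'(2) by auto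
    then show False unfolding X_def by auto
  qed
  have ge: "v' \<le> v"
  proof (rule ccontr)
    assume "\<not> v' \<le> v"
    then have "max u' v < v'" using uv'(1) by auto
    then obtain w where "max u' v < w" "w < v'" using dense by blast
    then have "w \<in> X r" "v < w" using uv'(2) by auto
    then show False unfolding X_def by auto
  qed
  \<comment> \<open>The radius \<open>\<delta> x\<close> itself may fail to be admissible, so a
    radius strictly below \<open>r\<close> is used.\<close>
  obtain s where s: "0 < s" "s < r" using dense r(1) by blast
  have "R x s" if x: "u' < x" "x < v'" for x
  proof -
    have "x \<in> X r" using x uv'(2) by auto
    then have "D x (\<delta> x)" "s < \<delta> x" using D_\<delta> s(2) unfolding X_def by auto
    then show ?thesis using s(1) unfolding D_def by auto
  qed
  with s(1) le ge uv'(1) show ?thesis by blast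
qed

text \<open>With \<open>W s t\<close> chosen as \<open>f s = f t\<close>, \<open>f s < f t\<close>
  or \<open>f s > f t\<close> this becomes constancy or strict monotonicity of \<open>f\<close> on
  the interval, so one argument serves all three cases.\<close>

definition related_on :: "('a \<Rightarrow> 'a \<Rightarrow> bool) \<Rightarrow> 'a \<Rightarrow> 'a \<Rightarrow> bool" where
  "related_on W u v \<longleftrightarrow> (\<forall>s t. u < s \<and> s < t \<and> t < v \<longrightarrow> W s t)"

text \<open>After the radius has been made uniform on a subinterval, that interval is shortened to
  length at most \<open>r\<close>; then any later point lies within \<open>r\<close> of any earlier
  one.\<close>

lemma related_on_subinterval:
  assumes W: "definable_pred M (\<lambda>e. W (e 0) (e 1))" and uv: "u < v"
    and ex: "\<And>x. u < x \<Longrightarrow> x < v \<Longrightarrow> \<exists>r>0. \<forall>t. x < t \<and> t < x + r \<longrightarrow> W x t"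
  shows "\<exists>u' v'. u \<le> u' \<and> u' < v' \<and> v' \<le> v \<and> related_on W u' v'"
proof -
  have "definable_pred M (\<lambda>e. \<forall>t. e 0 < t \<and> t < e 0 + e 1 \<longrightarrow> W (e 0) t)"
    by (intro definable_intros definable_pred_apply2[OF W])
  then have "\<exists>r>0. \<exists>u' v'. u \<le> u' \<and> u' < v' \<and> v' \<le> v \<and>
      (\<forall>x. u' < x \<and> x < v' \<longrightarrow> (\<forall>t. x < t \<and> t < x + r \<longrightarrow> W x t))"
  proof (rule uniform_radius[OF _ uv])
    show "\<exists>r>0. \<forall>t. x < t \<and> t < x + r \<longrightarrow> W x t" if "u < x" "x < v" for x
      using ex that by blast
    show "\<forall>t. x < t \<and> t < x + s \<longrightarrow> W x t"
      if "\<forall>t. x < t \<and> t < x + r \<longrightarrow> W x t" "0 < s" "s \<le> r" for x r s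
    proof (intro allI impI)
      fix t assume "x < t \<and> t < x + s"
      moreover have "x + s \<le> x + r" using that(3) by simp
      ultimately show "W x t" using that(1) by (meson less_le_trans)
    qed
  qed
  then obtain r u' v' where r: "r > 0" "u \<le> u'" "u' < v'" "v' \<le> v"
    "\<And>x t. u' < x \<Longrightarrow> x < v' \<Longrightarrow> x < t \<Longrightarrow> t < x + r \<Longrightarrow> W x t"
    by blast
  have "W s t" if st: "u' < s" "s < t" "t < min v' (u' + r)" for s t
  proof (rule r(5))
    show "u' < s" "s < t" using st by auto
    show "s < v'" using st by auto
    have "u' + r < s + r" using st(1) by simp
    then show "t < s + r" using st(3) by auto
  qed
  then show ?thesis
    using r(1-4) by (intro exI[of _ u'] exI[of _ "min v' (u' + r)"]) (auto simp: related_on_def)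
qed

text \<open>\<open>G W\<close> collects the points \<open>x\<close> such that \<open>W x t\<close>
  holds for all \<open>t\<close> just to the right of \<open>x\<close>. The three sets for equality,
  increase and decrease cover the line, so one of them contains a subinterval of the given interval,
  on which the radii can be made uniform.\<close>

lemma monotone_subinterval:
  assumes f: "definable_fun f" and uv: "u < v"
  shows "\<exists>u' v'. u \<le> u' \<and> u' < v' \<and> v' \<le> v \<and> (related_on (\<lambda>s t. f s = f t) u' v' \<or>
    related_on (\<lambda>s t. f s < f t) u' v' \<or> related_on (\<lambda>s t. f s > f t) u' v')"
proof -
  note deff = definable_map_apply[OF f]
  define G where "G W = {x. \<exists>r. r > 0 \<and> (\<forall>t. x < t \<and> t < x + r \<longrightarrow> W x t)}"
    for W :: "'a \<Rightarrow> 'a \<Rightarrow> bool"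
  define W1 where "W1 s t \<longleftrightarrow> f s = f t" for s t
  define W2 where "W2 s t \<longleftrightarrow> f s < f t" for s t
  define W3 where "W3 s t \<longleftrightarrow> f s > f t" for s t
  have defW: "definable_pred M (\<lambda>e. W1 (e 0) (e 1))" "definable_pred M (\<lambda>e. W2 (e 0) (e 1))"
    "definable_pred M (\<lambda>e. W3 (e 0) (e 1))"
    unfolding W1_def W2_def W3_def by (intro definable_intros deff)+
  have defG: "definable_set M (G W)" if "definable_pred M (\<lambda>e. W (e 0) (e 1))" for W
    unfolding G_def
    by (intro definable_set_Collect definable_intros definable_pred_apply2[OF that])
  have G_I: "x \<in> G W" if "x < y" "\<And>t. x < t \<Longrightarrow> t < y \<Longrightarrow> W x t" for x y W
    unfolding G_def using that by (auto intro!: exI[of _ "y - x"])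
  have sub: "\<exists>u' v'. a \<le> u' \<and> u' < v' \<and> v' \<le> b \<and> related_on W u' v'"
    if "definable_pred M (\<lambda>e. W (e 0) (e 1))" "a < b" "{a<..<b} \<subseteq> G W" for W a b
    using that(3) by (intro related_on_subinterval[OF that(1,2)]) (auto simp: G_def)
  have cover: "x \<in> G W1 \<union> (G W2 \<union> G W3)" for x
  proof -
    have "definable_set M {t. W1 x t}" "definable_set M {t. W2 x t}"
      by (intro definable_set_Collect definable_pred_apply2[OF defW(1)]
          definable_pred_apply2[OF defW(2)] definable_intros)+
    then obtain y z where y: "y > x" "{x<..<y} \<subseteq> {t. W1 x t} \<or> {x<..<y} \<inter> {t. W1 x t} = {}"
      and z: "z > x" "{x<..<z} \<subseteq> {t. W2 x t} \<or> {x<..<z} \<inter> {t. W2 x t} = {}"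
      using ex_right_interval by metis
    consider "{x<..<y} \<subseteq> {t. W1 x t}" | "{x<..<z} \<subseteq> {t. W2 x t}"
      | "{x<..<y} \<inter> {t. W1 x t} = {}" "{x<..<z} \<inter> {t. W2 x t} = {}"
      using y z by blast
    then show ?thesis
    proof cases
      case 1
      then have "x \<in> G W1" by (intro G_I[OF y(1)]) auto
      then show ?thesis by blast
    next
      case 2
      then have "x \<in> G W2" by (intro G_I[OF z(1)]) auto
      then show ?thesis by blast
    next
      case 3
      have "W3 x t" if "x < t" "t < min y z" for t
      proof -
        have "t \<in> {x<..<y}" "t \<in> {x<..<z}" using that by auto
        then have "\<not> W1 x t" "\<not> W2 x t" using 3 by blast+
        then show ?thesis by (auto simp: W1_def W2_def W3_def)
      qed
      then have "x \<in> G W3" using y(1) z(1) by (intro G_I[of x "min y z"]) auto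
      then show ?thesis by blast
    qed
  qed
  have "\<exists>a b. u \<le> a \<and> a < b \<and> b \<le> v \<and>
      ({a<..<b} \<subseteq> G W1 \<or> {a<..<b} \<subseteq> G W2 \<or> {a<..<b} \<subseteq> G W3)"
  proof -
    obtain a b where ab: "u \<le> a" "a < b" "b \<le> v"
      "{a<..<b} \<subseteq> G W1 \<or> {a<..<b} \<subseteq> G W2 \<union> G W3"
      using interval_subset_Un[OF defG[OF defW(1)] uv] cover by blast
    show ?thesis
    proof (cases "{a<..<b} \<subseteq> G W1")
      case True
      then show ?thesis using ab by blast
    next
      case False
      then obtain c d where "a \<le> c" "c < d" "d \<le> b" "{c<..<d} \<subseteq> G W2 \<or> {c<..<d} \<subseteq> G W3"
        using interval_subset_Un[OF defG[OF defW(2)] ab(2)] ab(4) by blast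
      then show ?thesis using ab order_trans by blast
    qed
  qed
  then obtain a b where ab: "u \<le> a" "a < b" "b \<le> v"
    "{a<..<b} \<subseteq> G W1 \<or> {a<..<b} \<subseteq> G W2 \<or> {a<..<b} \<subseteq> G W3" by blast
  then have "\<exists>u' v'. a \<le> u' \<and> u' < v' \<and> v' \<le> b \<and>
      (related_on W1 u' v' \<or> related_on W2 u' v' \<or> related_on W3 u' v')"
    using sub defW by meson
  then show ?thesis using ab order_trans unfolding W1_def W2_def W3_def by meson
qed

text \<open>Continuity at \<open>x\<close>, phrased with order intervals only. It is thus a
  first-order condition, and the points of continuity of a definable function form a definable
  set.\<close>

definition order_cont :: "('a \<Rightarrow> 'a) \<Rightarrow> 'a \<Rightarrow> bool" where
  "order_cont f x \<longleftrightarrow> (\<forall>p q. p < f x \<and> f x < q \<longrightarrow>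
    (\<exists>u v. u < x \<and> x < v \<and> (\<forall>t. u < t \<and> t < v \<longrightarrow> p < f t \<and> f t < q)))"

text \<open>The image is not thin, so \<open>f\<close> restricts to an order isomorphism onto an interval.\<close>

lemma strict_mono_cont_subinterval:
  assumes f: "definable_fun f" and uv: "u < v" and mono: "related_on (\<lambda>s t. f s < f t) u v"
  shows "\<exists>u' v'. u \<le> u' \<and> u' < v' \<and> v' \<le> v \<and> (\<forall>x. u' < x \<and> x < v' \<longrightarrow> order_cont f x)"
proof -
  have less: "f s < f t" if "u < s" "s < t" "t < v" for s t
    using mono that unfolding related_on_def by blast
  have less_iff: "f s < f t \<longleftrightarrow> s < t" if "s \<in> {u<..<v}" "t \<in> {u<..<v}" for s t
    using less[of s t] less[of t s] that by (cases s t rule: linorder_cases) auto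
  have inj: "inj_on f {u<..<v}"
    by (rule inj_onI) (metis less_iff less_irrefl linorder_neqE)
  have "{u<..<v} = {x. u < x \<and> x < v}" by auto
  then have defI: "definable_set M {u<..<v}"
    by (simp only:) (intro definable_set_Collect definable_intros)
  have "\<not> thin (f ` {u<..<v})"
    using thin_inj_image[OF defI f inj] thin_no_interval[OF _ uv] by blast
  then obtain p q where pq: "p < q" "{p<..<q} \<subseteq> f ` {u<..<v}"
    using not_thin_imp_interval[OF definable_set_image[OF defI f]] by blast
  \<comment> \<open>Two values inside the interval \<open>{p<..<q}\<close> have preimages
    \<open>a < b\<close>, and every value between them is attained between \<open>a\<close> and
    \<open>b\<close>.\<close>
  obtain y1 where y1: "p < y1" "y1 < q" using dense pq(1) by blast
  obtain y2 where y2: "y1 < y2" "y2 < q" using dense y1(2) by blast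
  have "y1 \<in> {p<..<q}" "y2 \<in> {p<..<q}" using y1 y2 by auto
  then have "y1 \<in> f ` {u<..<v}" "y2 \<in> f ` {u<..<v}" using pq(2) by blast+
  then obtain a b where a: "a \<in> {u<..<v}" "f a = y1" and b: "b \<in> {u<..<v}" "f b = y2"
    by (metis imageE)
  have ab: "a < b" using less_iff[OF a(1) b(1)] a(2) b(2) y2(1) by simp
  have onto: "\<exists>s. a < s \<and> s < b \<and> f s = y" if "f a < y" "y < f b" for y
  proof -
    have "y \<in> {p<..<q}" using that a(2) b(2) y1 y2 by auto
    then obtain s where s: "s \<in> {u<..<v}" "f s = y" using pq(2) by blast
    then show ?thesis using less_iff[OF a(1) s(1)] less_iff[OF s(1) b(1)] that by auto
  qed
  have "order_cont f x" if x: "a < x" "x < b" for x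
    unfolding order_cont_def
  proof (intro allI impI)
    fix p q assume pq: "p < f x \<and> f x < q"
    have xI: "x \<in> {u<..<v}" using x a(1) b(1) by auto
    \<comment> \<open>Intermediate values \<open>y\<close> below and \<open>z\<close> above
      \<open>f x\<close> are attained at points \<open>s\<close> and \<open>t\<close>; by
      monotonicity these bound a neighbourhood of \<open>x\<close> that is mapped between
      \<open>p\<close> and \<open>q\<close>.\<close>
    have "max p (f a) < f x" using pq x less_iff[OF a(1) xI] by auto
    then obtain y where y: "max p (f a) < y" "y < f x" using dense by blast
    have "f x < min q (f b)" using pq x less_iff[OF xI b(1)] by auto
    then obtain z where z: "f x < z" "z < min q (f b)" using dense by blast
    have "y < f b" "f a < z" using y z by auto
    then obtain s t where s: "a < s" "s < b" "f s = y" and t: "a < t" "t < b" "f t = z"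
      using onto y z by (meson max_less_iff_conj min_less_iff_conj)
    have sI: "s \<in> {u<..<v}" and tI: "t \<in> {u<..<v}" using s t a(1) b(1) by auto
    have "s < x" "x < t" using less_iff[OF sI xI] less_iff[OF xI tI] s(3) t(3) y(2) z(1) by auto
    moreover have "p < f w \<and> f w < q" if w: "s < w" "w < t" for w
    proof -
      have "w \<in> {u<..<v}" using w sI tI by auto
      then have "f s < f w" "f w < f t" using less_iff sI tI w by auto
      then show ?thesis using s(3) t(3) y(1) z(2) by auto
    qed
    ultimately show "\<exists>u v. u < x \<and> x < v \<and> (\<forall>t. u < t \<and> t < v \<longrightarrow> p < f t \<and> f t < q)"
      by blast
  qed
  then show ?thesis using ab a(1) b(1) by (intro exI[of _ a] exI[of _ b]) auto
qed

lemma order_cont_uminus: "order_cont (\<lambda>x. - f x) x \<Longrightarrow> order_cont f x"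
  unfolding order_cont_def
proof (intro allI impI)
  fix p q
  assume *: "\<forall>p q. p < - f x \<and> - f x < q \<longrightarrow>
      (\<exists>u v. u < x \<and> x < v \<and> (\<forall>t. u < t \<and> t < v \<longrightarrow> p < - f t \<and> - f t < q))"
    and "p < f x \<and> f x < q"
  then have "- q < - f x \<and> - f x < - p" by simp
  with * obtain u v where "u < x" "x < v"
    "\<forall>t. u < t \<and> t < v \<longrightarrow> - q < - f t \<and> - f t < - p" by blast
  then show "\<exists>u v. u < x \<and> x < v \<and> (\<forall>t. u < t \<and> t < v \<longrightarrow> p < f t \<and> f t < q)"
    by (intro exI[of _ u] exI[of _ v]) auto
qed

lemma strict_antimono_cont_subinterval:
  assumes f: "definable_fun f" and uv: "u < v" and mono: "related_on (\<lambda>s t. f s > f t) u v"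
  shows "\<exists>u' v'. u \<le> u' \<and> u' < v' \<and> v' \<le> v \<and> (\<forall>x. u' < x \<and> x < v' \<longrightarrow> order_cont f x)"
proof -
  have "definable_fun (\<lambda>x. - f x)" by (intro definable_intros definable_map_apply[OF f])
  moreover have "related_on (\<lambda>s t. - f s < - f t) u v"
    using mono unfolding related_on_def by simp
  ultimately show ?thesis
    using strict_mono_cont_subinterval[of "\<lambda>x. - f x", OF _ uv] order_cont_uminus by meson
qed

section \<open>From local to global behaviour\<close>

definition locally_related :: "('a \<Rightarrow> 'a \<Rightarrow> bool) \<Rightarrow> 'a \<Rightarrow> bool" where
  "locally_related W x \<longleftrightarrow> (\<exists>u v. u < x \<and> x < v \<and> related_on W u v)"

lemma definable_set_locally_related:
  assumes W: "definable_pred M (\<lambda>e. W (e 0) (e 1))"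
  shows "definable_set M {x. locally_related W x}"
  unfolding locally_related_def related_on_def
  by (intro definable_set_Collect definable_intros definable_pred_apply2[OF W])

lemma locally_related_open:
  assumes "locally_related W x"
  shows "\<exists>u v. u < x \<and> x < v \<and> (\<forall>t. u < t \<and> t < v \<longrightarrow> locally_related W t)"
  using assms unfolding locally_related_def by blast

text \<open>Two points slightly to the right of \<open>x\<close> lie in both neighbourhoods. Applied
  to equality, increase and decrease of \<open>f\<close>, this shows that at most one of the three
  holds locally at a given point.\<close>

lemma locally_related_unique:
  assumes "locally_related W x" "locally_related W' x"
  shows "\<exists>s t. W s t \<and> W' s t"
proof -
  obtain u v u' v' where "u < x" "x < v" "related_on W u v" "u' < x" "x < v'" "related_on W' u' v'"
    using assms unfolding locally_related_def by blast
  moreover obtain t where "x < t" "t < min v v'"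
    using dense[of x "min v v'"] calculation by auto
  moreover obtain s where "x < s" "s < t"
    using dense calculation by blast
  ultimately have "W s t \<and> W' s t" unfolding related_on_def by (meson less_trans min_less_iff_conj)
  then show ?thesis by blast
qed

text \<open>Definable completeness replaces compactness of the segment. Let \<open>c\<close> be the
  supremum of the points up to which \<open>x\<close> is related to everything after it. The
  relation holds throughout a neighbourhood of \<open>c\<close>, so transitivity carries it beyond
  \<open>c\<close>, which is impossible unless \<open>c = y\<close>.\<close>

lemma locally_related_imp_related:
  assumes W: "definable_pred M (\<lambda>e. W (e 0) (e 1))"
    and trans: "\<And>r s t. W r s \<Longrightarrow> W s t \<Longrightarrow> W r t"
    and loc: "\<And>c. x \<le> c \<Longrightarrow> c \<le> y \<Longrightarrow> locally_related W c" and xy: "x < y"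
  shows "W x y"
proof -
  define S where "S = {t. x \<le> t \<and> t \<le> y \<and> (\<forall>r. x < r \<and> r \<le> t \<longrightarrow> W x r)}"
  have "definable_set M S"
    unfolding S_def by (intro definable_set_Collect definable_intros definable_pred_apply2[OF W])
  moreover have xS: "x \<in> S" using xy unfolding S_def by auto
  ultimately have "\<exists>c. (\<forall>t\<in>S. t \<le> c) \<and> (\<forall>u<c. \<exists>t\<in>S. u < t)"
    by (rule definable_supremum[where B = y]) (simp add: S_def)
  then obtain c where c: "\<forall>t\<in>S. t \<le> c" "\<And>u. u < c \<Longrightarrow> \<exists>t\<in>S. u < t" by blast
  have "x \<le> c" using c(1) xS by blast
  have "c \<le> y"
  proof (rule ccontr)
    assume "\<not> c \<le> y"
    then obtain t where "t \<in> S" "y < t" using c(2)[of y] by auto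
    then show False unfolding S_def by auto
  qed
  obtain u v where uv: "u < c" "c < v" "related_on W u v"
    using loc[OF \<open>x \<le> c\<close> \<open>c \<le> y\<close>] unfolding locally_related_def by blast
  have step: "W s t" if "u < s" "s < t" "t < v" for s t
    using uv(3) that unfolding related_on_def by blast
  have Wx: "W x r" if r: "x < r" "r < v" for r
  proof (cases "x < c")
    case True
    \<comment> \<open>The intermediate point \<open>t\<close> is already reached from
      \<open>x\<close> and also lies to the right of \<open>u\<close>, so a later \<open>r\<close>
      is reached from \<open>t\<close> inside the neighbourhood of \<open>c\<close>.\<close>
    then obtain t where t: "t \<in> S" "max u x < t" using c(2)[of "max u x"] uv(1) by auto
    show ?thesis
    proof (cases "r \<le> t")
      case True
      then show ?thesis using t(1) r(1) unfolding S_def by blast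
    next
      case False
      have "W x t" using t unfolding S_def by auto
      moreover have "W t r" using step[of t r] t(2) False r(2) by auto
      ultimately show ?thesis by (rule trans)
    qed
  next
    case False
    \<comment> \<open>Here \<open>x = c\<close>, so \<open>x\<close> itself lies in the
      neighbourhood of \<open>c\<close>.\<close>
    then show ?thesis using step[of x r] \<open>x \<le> c\<close> uv(1) r by auto
  qed
  have "c = y"
  proof (rule ccontr)
    assume "c \<noteq> y"
    then have "c < min v y" using \<open>c \<le> y\<close> uv(2) by auto
    then obtain t where t: "c < t" "t < min v y" using dense by blast
    then have "t \<in> S" using Wx \<open>x \<le> c\<close> unfolding S_def by auto
    then show False using c(1) t(1) by auto
  qed
  then show ?thesis using Wx[OF xy] uv(2) by simp
qed

section \<open>Decomposition into pieces with uniform behaviour\<close>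

lemma order_cont_continuous_on:
  assumes "\<And>x. x \<in> I \<Longrightarrow> order_cont f x"
  shows "continuous_on I f"
proof (rule continuous_at_imp_continuous_on, rule ballI)
  fix x assume x: "x \<in> I"
  have nhd: "\<forall>\<^sub>F t in at x. p < f t \<and> f t < q" if pq: "p < f x" "f x < q" for p q
  proof -
    obtain u v where "u < x" "x < v" "\<forall>t. u < t \<and> t < v \<longrightarrow> p < f t \<and> f t < q"
      using assms[OF x] pq unfolding order_cont_def by meson
    then show ?thesis
      unfolding eventually_at_topological by (intro exI[of _ "{u<..<v}"]) auto
  qed
  have "(f \<longlongrightarrow> f x) (at x)"
  proof (rule order_tendstoI)
    fix p assume "p < f x"
    then show "\<forall>\<^sub>F t in at x. p < f t"
      using nhd[of p "f x + 1"] by (simp add: eventually_conj_iff less_add_one)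
  next
    fix q assume "f x < q"
    then show "\<forall>\<^sub>F t in at x. f t < q"
      using nhd[of "f x - 1" q] by (simp add: eventually_conj_iff)
  qed
  then show "isCont f x" by (simp add: isCont_def)
qed

text \<open>
  Being in the set of points where \<open>f\<close> is locally related by \<open>W\<close> is itself a locally constant
  property, so that one alternative prevails on all of \<open>I\<close>.
\<close>

lemma piecewise_monotone:
  assumes f: "definable_fun f" and U: "definable_set M U"
  shows "\<exists>A\<subseteq>U. thin A \<and> (\<forall>I. I \<subseteq> U - A \<longrightarrow> (\<forall>x\<in>I. \<forall>y\<in>I. \<forall>c. x \<le> c \<and> c \<le> y \<longrightarrow> c \<in> I) \<longrightarrow>
    f constant_on I \<or> ((strict_mono_on I f \<or> strict_antimono_on I f) \<and> continuous_on I f))"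
proof -
  note deff = definable_map_apply[OF f]
  define W1 where "W1 s t \<longleftrightarrow> f s = f t" for s t
  define W2 where "W2 s t \<longleftrightarrow> f s < f t" for s t
  define W3 where "W3 s t \<longleftrightarrow> f s > f t" for s t
  define \<W> where "\<W> = {W1, W2, W3}"
  have defW: "definable_pred M (\<lambda>e. W (e 0) (e 1))" if "W \<in> \<W>" for W
  proof -
    have "definable_pred M (\<lambda>e. W1 (e 0) (e 1))" "definable_pred M (\<lambda>e. W2 (e 0) (e 1))"
      "definable_pred M (\<lambda>e. W3 (e 0) (e 1))"
      unfolding W1_def W2_def W3_def by (intro definable_intros deff)+
    then show ?thesis using that unfolding \<W>_def by auto
  qed
  have transW: "W r t" if "W \<in> \<W>" "W r s" "W s t" for W r s t
    using that unfolding \<W>_def W1_def W2_def W3_def by auto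
  have disjW: "W = W'" if "W \<in> \<W>" "W' \<in> \<W>" "locally_related W x" "locally_related W' x" for W W' x
    using locally_related_unique[OF that(3,4)] that(1,2)
    unfolding \<W>_def W1_def W2_def W3_def by auto
  \<comment> \<open>Continuity is demanded only in the strictly monotone cases.\<close>
  define Good where "Good x \<longleftrightarrow> locally_related W1 x \<or>
    (locally_related W2 x \<or> locally_related W3 x) \<and> order_cont f x" for x
  have loc_mem: "definable_pred M (\<lambda>e. locally_related W (e 0))" if "W \<in> \<W>" for W
    using definable_set_locally_related[OF defW[OF that]] by (simp add: definable_set_iff_pred)
  have def_cont: "definable_pred M (\<lambda>e. order_cont f (e 0))"
    unfolding order_cont_def by (intro definable_intros deff)
  define A where "A = {x. x \<in> U \<and> \<not> Good x}"
  have "definable_set M A"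
    unfolding A_def Good_def
    by (intro definable_set_Collect definable_intros loc_mem def_cont definable_pred_mem[OF U])
      (simp_all add: \<W>_def)
  moreover have "\<not> {u<..<v} \<subseteq> A" if uv: "u < v" for u v
  proof -
    obtain a b where ab: "u \<le> a" "a < b" "b \<le> v"
      "related_on W1 a b \<or> related_on W2 a b \<or> related_on W3 a b"
      using monotone_subinterval[OF f uv] unfolding W1_def W2_def W3_def by blast
    have loc: "locally_related W x" if "related_on W a b" "a < x" "x < b" for W x
      using that unfolding locally_related_def by blast
    have "\<exists>x. a < x \<and> x < b \<and> Good x"
    proof (cases "related_on W1 a b")
      case True
      then show ?thesis using dense[OF ab(2)] loc unfolding Good_def by blast
    next
      case False
      then have "\<exists>u' v'. a \<le> u' \<and> u' < v' \<and> v' \<le> b \<and>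
          (\<forall>x. u' < x \<and> x < v' \<longrightarrow> order_cont f x)"
        using strict_mono_cont_subinterval[OF f ab(2)]
          strict_antimono_cont_subinterval[OF f ab(2)] ab(4)
        unfolding W2_def W3_def by blast
      then obtain u' v' where *: "a \<le> u'" "u' < v'" "v' \<le> b"
        "\<forall>x. u' < x \<and> x < v' \<longrightarrow> order_cont f x" by blast
      obtain x where "u' < x" "x < v'" using dense *(2) by blast
      then have "a < x" "x < b" "order_cont f x" using * by auto
      then show ?thesis using False ab(4) loc unfolding Good_def by blast
    qed
    then obtain x where "a < x" "x < b" "Good x" by blast
    then have "x \<in> {u<..<v}" "x \<notin> A" using ab unfolding A_def by auto
    then show ?thesis by blast
  qed
  ultimately have "thin A" unfolding thin_def by blast
  moreover have "A \<subseteq> U" unfolding A_def by blast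
  moreover have "f constant_on I \<or>
      ((strict_mono_on I f \<or> strict_antimono_on I f) \<and> continuous_on I f)"
    if I: "I \<subseteq> U - A" and convex: "\<forall>x\<in>I. \<forall>y\<in>I. \<forall>c. x \<le> c \<and> c \<le> y \<longrightarrow> c \<in> I" for I
  proof (cases "I = {}")
    case True
    then show ?thesis by (simp add: constant_on_def)
  next
    case False
    have good: "Good x" if "x \<in> I" for x using that I unfolding A_def by blast
    then have cover: "\<exists>W\<in>\<W>. locally_related W x" if "x \<in> I" for x
      using that unfolding Good_def \<W>_def by blast
    from False obtain z where "z \<in> I" by blast
    then obtain W where W: "W \<in> \<W>" "locally_related W z" using cover by blast
    \<comment> \<open>\<open>V\<close> is transitive as well, so the passage from local to global is
      made twice: first for \<open>V\<close>, which spreads the alternative \<open>W\<close> from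
      \<open>z\<close> over all of \<open>I\<close>, and then for \<open>W\<close> itself.\<close>
    define V where "V s t \<longleftrightarrow> (locally_related W s \<longleftrightarrow> locally_related W t)" for s t
    have defV: "definable_pred M (\<lambda>e. V (e 0) (e 1))"
      unfolding V_def
      by (intro definable_intros definable_pred_apply[OF loc_mem[OF W(1)]])
    have locV: "locally_related V c" if c: "c \<in> I" for c
    proof -
      obtain W' where W': "W' \<in> \<W>" "locally_related W' c" using cover c by blast
      then obtain u v where uv: "u < c" "c < v" "\<forall>t. u < t \<and> t < v \<longrightarrow> locally_related W' t"
        using locally_related_open by blast
      \<comment> \<open>Near \<open>c\<close> the alternative \<open>W'\<close> holds at every point
        and excludes the others, so the truth value of \<open>locally_related W t\<close> does not
        depend on \<open>t\<close>.\<close>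
      then have "locally_related W t \<longleftrightarrow> W = W'" if "u < t" "t < v" for t
        using disjW W W' that by blast
      then have "related_on V u v" unfolding related_on_def V_def by (metis less_trans)
      then show ?thesis using uv(1,2) unfolding locally_related_def by blast
    qed
    have V_rel: "V x y" if "x \<in> I" "y \<in> I" "x < y" for x y
    proof (rule locally_related_imp_related[OF defV _ _ that(3)])
      show "V r t" if "V r s" "V s t" for r s t using that unfolding V_def by blast
      show "locally_related V c" if "x \<le> c" "c \<le> y" for c
        using locV convex \<open>x \<in> I\<close> \<open>y \<in> I\<close> that by blast
    qed
    have locW: "locally_related W x" if "x \<in> I" for x
      using V_rel[OF that \<open>z \<in> I\<close>] V_rel[OF \<open>z \<in> I\<close> that] W(2) unfolding V_def
      by (cases x z rule: linorder_cases) auto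
    have rel: "W x y" if "x \<in> I" "y \<in> I" "x < y" for x y
    proof (rule locally_related_imp_related[OF defW[OF W(1)] transW[OF W(1)] _ that(3)])
      show "locally_related W c" if "x \<le> c" "c \<le> y" for c
        using locW convex \<open>x \<in> I\<close> \<open>y \<in> I\<close> that by blast
    qed
    show ?thesis
    proof (cases "W = W1")
      case True
      have "f x = f z" if "x \<in> I" for x
        using rel[OF that \<open>z \<in> I\<close>] rel[OF \<open>z \<in> I\<close> that] True unfolding W1_def
        by (cases x z rule: linorder_cases) auto
      then show ?thesis by (auto simp: constant_on_def)
    next
      case False
      have "\<not> locally_related W1 x" if "x \<in> I" for x
        using disjW[OF W(1) _ locW[OF that]] False unfolding \<W>_def by blast
      then have "continuous_on I f"
        using good unfolding Good_def by (intro order_cont_continuous_on) blast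
      moreover have "strict_mono_on I f \<or> strict_antimono_on I f"
        using rel False W(1) unfolding \<W>_def W2_def W3_def
        by (auto simp: monotone_on_def)
      ultimately show ?thesis by blast
    qed
  qed
  ultimately show ?thesis by blast
qed

text \<open>The \<open>LEAST\<close> in \<^const>\<open>next_point\<close> exists because subsets of thin sets have minima.\<close>

lemma ext_interval_next_point:
  assumes A: "thin A" "A \<subseteq> ext_interval a b" and x: "x \<in> insert a (Fin ` A)"
  shows "ext_interval x (next_point a b A x) \<subseteq> ext_interval a b - A"
proof (cases "x = a")
  case True
  show ?thesis
  proof (cases "A = {}")
    case True
    then show ?thesis using \<open>x = a\<close> by (simp add: next_point_def)
  next
    case False
    then obtain m where m: "m \<in> A" "\<forall>y\<in>A. m \<le> y" using thin_min[OF A(1)] by blast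
    then have "(LEAST y. y \<in> A) = m" by (intro Least_equality) auto
    then have "next_point a b A x = Fin m" using True False \<open>x = a\<close> by (simp add: next_point_def)
    moreover have "Fin m < b" using m(1) A(2) unfolding ext_interval_def by blast
    then have "Fin t < b" if "t < m" for t using that by (cases b) auto
    ultimately show ?thesis using m(2) \<open>x = a\<close> unfolding ext_interval_def by auto
  qed
next
  case False
  then obtain y where y: "x = Fin y" "y \<in> A" using x by blast
  have "a < Fin y" using y(2) A(2) unfolding ext_interval_def by blast
  then have above: "a < Fin t" if "y < t" for t using that by (cases a) auto
  show ?thesis
  proof (cases "\<forall>z\<in>A. z \<le> y")
    case True
    then have "next_point a b A x = b" using False y by (simp add: next_point_def)
    then show ?thesis using above True y(1) unfolding ext_interval_def by auto
  next
    case False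
    define C where "C = {z. z \<in> A \<and> y < z}"
    have "definable_set M C" unfolding C_def
      by (intro definable_set_Collect definable_intros definable_pred_mem
          thin_definable[OF A(1)])
    moreover have "C \<subseteq> A" unfolding C_def by blast
    ultimately have "thin C" by (intro thin_subset[OF A(1)])
    moreover have "C \<noteq> {}" using False unfolding C_def by auto
    ultimately obtain m where m: "m \<in> C" "\<forall>z\<in>C. m \<le> z" using thin_min by blast
    then have least: "(LEAST z. z \<in> A \<and> x < Fin z) = m"
      unfolding C_def y(1) by (intro Least_equality) auto
    have "\<not> (\<forall>z\<in>A. Fin z \<le> x)" using False y(1) by simp
    then have "next_point a b A x = Fin m"
      by (simp only: next_point_def if_not_P[OF \<open>x \<noteq> a\<close>] least if_False)
    moreover have "Fin m < b" using m(1) A(2) unfolding C_def ext_interval_def by blast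
    then have "Fin t < b" if "t < m" for t using that by (cases b) auto
    ultimately show ?thesis using m(2) y(1) above unfolding ext_interval_def C_def by force
  qed
qed

end

theorem theorem6p3:
  fixes M :: "('a::{linordered_field, linorder_topology}, 'f, 'r) expansion"
    and a b :: "'a extended"
    and f :: "'a \<Rightarrow> 'a"
  assumes "definably_complete M"
    and "locally_o_minimal M"
    and "a < b"
    and "definable_fun_on M (ext_interval a b) f"
  shows "\<exists>A. pseudo_finite M A \<and> A \<subseteq> ext_interval a b \<and>
    (\<forall>x \<in> insert a (Fin ` A).
      let I = ext_interval x (next_point a b A x) in
        f constant_on I \<or>
        ((strict_mono_on I f \<or> strict_antimono_on I f) \<and> continuous_on I f))"
proof -
  interpret tame_field M by (rule tame_field.intro) (fact assms)+
  define U where "U = ext_interval a b"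
  \<comment> \<open>\<open>definable_fun\<close> concerns total functions, so \<open>f\<close> is
    extended by \<open>0\<close>. All pieces lie inside \<open>U\<close>, where \<open>g\<close> and
    \<open>f\<close> agree.\<close>
  define g where "g x = (if x \<in> U then f x else 0)" for x
  have defU: "definable_set M U" unfolding U_def by (rule definable_set_ext_interval)
  have "definable_pred M (\<lambda>e. (e 0 \<in> U \<and> e 1 = f (e 0)) \<or> \<not> e 0 \<in> U \<and> e 1 = 0)"
    using assms(4) unfolding definable_fun_on_iff_pred U_def[symmetric]
    by (intro definable_pred_disj) (auto intro!: definable_intros definable_pred_mem[OF defU])
  moreover have "((e 0 \<in> U \<and> e 1 = f (e 0)) \<or> \<not> e 0 \<in> U \<and> e 1 = 0) \<longleftrightarrow> e 1 = g (e 0)"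
    for e :: "nat \<Rightarrow> 'a"
    by (auto simp: g_def)
  ultimately have "definable_fun g" by simp
  from piecewise_monotone[OF this defU] obtain A where A: "A \<subseteq> U" "thin A"
    and piece: "\<forall>I. I \<subseteq> U - A \<longrightarrow> (\<forall>x\<in>I. \<forall>y\<in>I. \<forall>c. x \<le> c \<and> c \<le> y \<longrightarrow> c \<in> I) \<longrightarrow>
      g constant_on I \<or> ((strict_mono_on I g \<or> strict_antimono_on I g) \<and> continuous_on I g)"
    by (elim exE conjE)
  have "f constant_on I \<or> ((strict_mono_on I f \<or> strict_antimono_on I f) \<and> continuous_on I f)"
    if x: "x \<in> insert a (Fin ` A)" and I: "I = ext_interval x (next_point a b A x)" for x I
  proof -
    have sub: "I \<subseteq> U - A"
      unfolding I U_def using ext_interval_next_point[OF A(2) _ x] A(1) by (simp add: U_def)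
    have "c \<in> I" if "s \<in> I" "t \<in> I" "s \<le> c" "c \<le> t" for s t c
    proof -
      have "Fin s \<le> Fin c" "Fin c \<le> Fin t" using that by simp_all
      then show ?thesis using that(1,2) unfolding I ext_interval_def mem_Collect_eq
        by (blast intro: less_le_trans le_less_trans)
    qed
    then have convex: "\<forall>x\<in>I. \<forall>y\<in>I. \<forall>c. x \<le> c \<and> c \<le> y \<longrightarrow> c \<in> I" by blast
    have pieces: "g constant_on I \<or>
        ((strict_mono_on I g \<or> strict_antimono_on I g) \<and> continuous_on I g)"
      by (rule mp[OF mp[OF spec[OF piece] sub] convex])
    have eq: "g t = f t" if "t \<in> I" for t using sub that by (auto simp: g_def)
    have "continuous_on I g = continuous_on I f" using eq by (intro continuous_on_cong) auto
    moreover have "g constant_on I \<longleftrightarrow> f constant_on I" using eq by (simp add: constant_on_def)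
    moreover have "strict_mono_on I g = strict_mono_on I f"
      "strict_antimono_on I g = strict_antimono_on I f"
      using eq by (simp_all add: monotone_on_def)
    ultimately show ?thesis using pieces by simp
  qed
  then show ?thesis
    using A(1) thin_pseudo_finite[OF A(2)] unfolding Let_def U_def
    by (intro exI[of _ A] conjI ballI) simp_all
qed

end
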